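(* Let $\mathbb{K}$ be a field. Let $X\in\mathbb{K}^{d\times N}$ be a matrix of rank $d\le N$. Suppose that the matroid represented by $X$ is regular. Then: (i) For any integer $k$, there is $X_k\in\mathbb{K}^{d\times N}$ such that $\Delta_I(X)^k=\pm\Delta_I(X_k)$ for every $I\in\binom{[N]}{d}$ (the sign may depend on $I$). (ii) If $k$ is an odd integer, then there is $X_k\in\mathbb{K}^{d\times N}$ such that the stronger equalities $\Delta_I(X)^k=\Delta_I(X_k)$ hold for all $I\in\binom{[N]}{d}$. (iii) If $\mathbb{K}$ is an ordered field, then for all $k$ such that the expression $x^k$ is well-defined for all positive elements $x$ of $\mathbb{K}$ (e.g. $k\in\mathbb{Z}$, or $\mathbb{K}=\mathbb{R}$ and $k\in\mathbb{R}$), there is $X_k\in\mathbb{K}^{d\times N}$ such that $|\Delta_I(X)|^k=|\Delta_I(X_k)|$ and $\Delta_I(X_k)\cdot\Delta_I(X)\ge 0$ for all $I\in\binom{[N]}{d}$.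
   Context: $[N]=\{1,\dots,N\}$ and $\binom{[N]}{d}$ is the set of $d$-element subsets of $[N]$. $\Delta_I(X)$ is the determinant of the square submatrix of $X$ formed by the columns indexed by $I$. The matroid represented by $X$ is the matroid on $[N]$ given by linear rank of sets of columns. A matroid is regular if it can be represented over every field, equivalently by a totally unimodular matrix. In an ordered field, $|x|=x$ if $x\ge0$ and $|x|=-x$ otherwise. Convention: $0^k=0$ for every exponent $k$ under consideration (in particular $0^0=0$), so that a vanishing minor of $X$ must correspond to a vanishing minor of $X_k$. In (iii), "$x^k$ is well-defined for all positive $x$" means that there is a power map $x\mapsto x^k$ from the positive elements of $\mathbb{K}$ to the positive elements of $\mathbb{K}$ obeying $(xy)^k=x^ky^k$. *)

theory Defs
  imports
    "Jordan_Normal_Form.DL_Rank"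
    "Jordan_Normal_Form.DL_Submatrix"
    "HOL-Library.FuncSet"
    Complex_Main
begin

text \<open>
  Rows and columns are numbered from 0, as in the matrix library, so the set of column labels is
  \<open>{..<N}\<close> instead of \<open>{1..N}\<close>. The library function \<open>submatrix X I J\<close> keeps the rows in \<open>I\<close> and
  the columns in \<open>J\<close>, in increasing order.
\<close>

definition minor :: "'a::comm_ring_1 mat \<Rightarrow> nat set \<Rightarrow> 'a" where
  "minor X I = det (submatrix X UNIV I)"

text \<open>
  A matroid on a set of labels is given as the pair of its ground set and its rank function.
  The rank function is restricted to subsets of the ground set, so that equality of such pairs is
  equality of (labelled) matroids. The ranks are those of the column submatrices.
\<close>

definition matroid_of :: "'a::field mat \<Rightarrow> nat set \<times> (nat set \<Rightarrow> nat)" where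
  "matroid_of X =
     ({..<dim_col X},
      \<lambda>S\<in>Pow {..<dim_col X}. vec_space.rank (dim_row X) (submatrix X UNIV S))"

definition totally_unimodular :: "'a::comm_ring_1 mat \<Rightarrow> bool" where
  "totally_unimodular T \<longleftrightarrow>
     (\<forall>I J. I \<subseteq> {..<dim_row T} \<longrightarrow> J \<subseteq> {..<dim_col T} \<longrightarrow> card I = card J \<longrightarrow>
        det (submatrix T I J) \<in> {-1, 0, 1})"

text \<open>
  Regularity is representability by a real totally unimodular matrix. (Representability over all
  fields quantifies over types, which a HOL formula cannot do.) The number of rows of the
  totally unimodular matrix is not prescribed.
\<close>

definition regular_matroid :: "nat set \<times> (nat set \<Rightarrow> nat) \<Rightarrow> bool" where
  "regular_matroid M \<longleftrightarrow> (\<exists>T :: real mat. totally_unimodular T \<and> matroid_of T = M)"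

text \<open>
  Powers follow the convention that 0 to the power \<open>k\<close> is 0 for every \<open>k\<close>; note that \<open>powi\<close>
  has \<open>0 powi 0 = 1\<close>.
\<close>

definition int_pow0 :: "'a::field \<Rightarrow> int \<Rightarrow> 'a" where
  "int_pow0 x k = (if x = 0 then 0 else x powi k)"

text \<open>
  An exponent for which powers of positive elements are well defined is represented by its power
  map \<open>p\<close>, where \<open>p x\<close> stands for \<open>x\<close> to the power \<open>k\<close>.
\<close>

definition power_map :: "('a::linordered_field \<Rightarrow> 'a) \<Rightarrow> bool" where
  "power_map p \<longleftrightarrow> (\<forall>x>0. p x > 0) \<and> (\<forall>x>0. \<forall>y>0. p (x * y) = p x * p y)"

definition ext0 :: "('a::zero \<Rightarrow> 'a) \<Rightarrow> 'a \<Rightarrow> 'a" where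
  "ext0 p x = (if x = 0 then 0 else p x)"

lemma power_map_powi: "power_map (\<lambda>x. x powi k)"
  by (auto simp: power_map_def power_int_mult_distrib)

lemma power_map_powr: "power_map (\<lambda>x::real. x powr r)"
  by (auto simp: power_map_def powr_mult)

end

theory Submission
  imports Defs "Jordan_Normal_Form.DL_Rank_Submatrix"
begin

text \<open>
  The matroid of a regular matrix determines the matrix up to row operations and column scaling:
  \<open>X = G U D\<close> with \<open>G\<close> invertible, \<open>D\<close> diagonal and invertible, and \<open>U\<close> the image of an integer
  matrix all of whose maximal minors are \<open>-1\<close>, \<open>0\<close> or \<open>1\<close>. The maximal minors of \<open>X\<close> are therefore
  \<open>\<gamma> * (\<Prod>j\<in>I. c j) * \<epsilon> I\<close> with \<open>\<epsilon> I \<in> {-1, 0, 1}\<close> (\<open>minors_of_regular_matrix\<close>). If \<open>f\<close> is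
  multiplicative on nonzero elements, the matrix built from the same \<open>U\<close> with \<open>f \<gamma>\<close> and \<open>f (c j)\<close>
  in place of \<open>\<gamma>\<close> and \<open>c j\<close> has the minors \<open>f \<gamma> * (\<Prod>j\<in>I. f (c j)) * \<epsilon> I\<close>. These are the
  images under \<open>f\<close> of the nonzero minors of \<open>X\<close>, up to a factor \<open>- f (-1)\<close> where \<open>\<epsilon> I = -1\<close>
  (\<open>minors_under_multiplicative_map\<close>). The three claims are the cases \<open>f x = x powi k\<close>, the same
  with \<open>f (-1) = -1\<close> for odd \<open>k\<close>, and \<open>f x = sgn x * p \<bar>x\<bar>\<close>.

  The factorization rests on two facts. First, the matroid has an integer model with \<open>d\<close> rows and
  minors in \<open>{-1, 0, 1}\<close> (\<open>unimodular_model\<close>): a totally unimodular representation \<open>T\<close> may have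
  more than \<open>d\<close> rows, but \<open>d\<close> of them suffice, and they are found by expanding the Gram determinant
  of a column basis over all choices of \<open>d\<close> rows.

  Second, the model is unique up to scaling rows and columns (\<open>scaling_equivalent_up_to\<close>). Reduce
  both matrices to the identity on a common basis. Whether an entry vanishes is then a matroid
  property, so the supports agree. Columns are scaled one after the other. When column \<open>e\<close> is
  added, the scaling of the earlier columns still leaves one free factor for each connected component
  of the graph that joins rows meeting a common earlier column; so it suffices that the ratio
  between the two matrices in column \<open>e\<close> is constant on components. Two rows at minimal distance with
  different ratios would be the ends of a chordless path on whose inner rows column \<open>e\<close> vanishes. Up
  to a factor, a single row vector supported on the path annihilates the columns of the path. In the integer model its
  coefficients are \<open>\<plusminus>1\<close>, so its product with column \<open>e\<close> is a sum of two units and hence even. The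
  minor on the path columns, column \<open>e\<close> and the basis columns of the remaining rows is then even,
  and so it is \<open>0\<close> by unimodularity. Hence these columns are dependent in both matrices, which makes
  the two ratios at the ends of the path equal, a contradiction.
\<close>

section \<open>Submatrices and minors\<close>

lemma submatrix_within:
  assumes "A \<in> carrier_mat m N" "I \<subseteq> {..<m}" "J \<subseteq> {..<N}"
  shows "submatrix A I J \<in> carrier_mat (card I) (card J)"
    and "i < card I \<Longrightarrow> j < card J \<Longrightarrow> submatrix A I J $$ (i, j) = A $$ (pick I i, pick J j)"
proof -
  have "{i. i < m \<and> i \<in> I} = I" "{j. j < N \<and> j \<in> J} = J" using assms by auto
  then show "submatrix A I J \<in> carrier_mat (card I) (card J)"
    and "i < card I \<Longrightarrow> j < card J \<Longrightarrow> submatrix A I J $$ (i, j) = A $$ (pick I i, pick J j)"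
    using assms(1) by (auto simp: submatrix_def)
qed

lemma submatrix_all_rows:
  assumes "A \<in> carrier_mat m N" "J \<subseteq> {..<N}"
  shows "submatrix A UNIV J \<in> carrier_mat m (card J)"
    and "i < m \<Longrightarrow> j < card J \<Longrightarrow> submatrix A UNIV J $$ (i, j) = A $$ (i, pick J j)"
proof -
  have "{j. j < N \<and> j \<in> J} = J" using assms by auto
  then show "submatrix A UNIV J \<in> carrier_mat m (card J)"
    and "i < m \<Longrightarrow> j < card J \<Longrightarrow> submatrix A UNIV J $$ (i, j) = A $$ (i, pick J j)"
    using assms(1) by (auto simp: submatrix_def pick_UNIV)
qed

lemma bij_betw_pick:
  assumes "finite I"
  shows "bij_betw (pick I) {..<card I} I"
proof -
  have inj: "inj_on (pick I) {..<card I}"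
    by (rule linorder_inj_onI) (use pick_mono_le in fastforce)+
  moreover have "pick I ` {..<card I} \<subseteq> I" using pick_in_set_le by auto
  ultimately have "pick I ` {..<card I} = I"
    using assms by (intro card_subset_eq) (auto simp: card_image)
  then show ?thesis using inj by (simp add: bij_betw_def)
qed

lemma ball_pick:
  assumes "finite I"
  shows "(\<forall>e\<in>I. P e) \<longleftrightarrow> (\<forall>j<card I. P (pick I j))"
  using bij_betw_imp_surj_on[OF bij_betw_pick[OF assms]] by (metis imageE imageI lessThan_iff)

lemma pick_less: "I \<subseteq> {..<N} \<Longrightarrow> j < card I \<Longrightarrow> pick I j < N"
  using pick_in_set_le[of j I] by auto

lemma finite_below: "I \<subseteq> {..<N} \<Longrightarrow> finite (I :: nat set)"
  by (rule finite_subset) auto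

lemma submatrix_mult_left:
  assumes "P \<in> carrier_mat m d" "A \<in> carrier_mat d N" "I \<subseteq> {..<N}"
  shows "submatrix (P * A) UNIV I = P * submatrix A UNIV I"
proof -
  note sA = submatrix_all_rows[OF assms(2,3)]
  have PA: "P * A \<in> carrier_mat m N" using assms by simp
  note sPA = submatrix_all_rows[OF PA assms(3)]
  show ?thesis
  proof (rule eq_matI)
    fix i j assume "i < dim_row (P * submatrix A UNIV I)" "j < dim_col (P * submatrix A UNIV I)"
    then have ij: "i < m" "j < card I" using assms(1) sA(1) by auto
    have p: "pick I j < N" using pick_less assms ij by auto
    show "submatrix (P * A) UNIV I $$ (i, j) = (P * submatrix A UNIV I) $$ (i, j)"
      using ij p assms(1,2) sA(1)
      by (auto simp: sPA(2) sA(2) scalar_prod_def intro!: sum.cong)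
  qed (use assms(1) sA(1) sPA(1) in auto)
qed

lemma minor_mult_left:
  assumes "P \<in> carrier_mat d d" "A \<in> carrier_mat d N" "I \<subseteq> {..<N}" "card I = d"
  shows "minor (P * A) I = det P * minor A I"
  using submatrix_all_rows(1)[OF assms(2,3)] assms
  by (simp add: minor_def submatrix_mult_left det_mult[where n = d])

lemma det_mat_diag: "det (mat_diag n f) = (\<Prod>i<n. f i)"
proof -
  have "det (mat_diag n f) = prod_list (diag_mat (mat_diag n f))"
    by (rule det_upper_triangular[of _ n]) (auto simp: mat_diag_def)
  also have "\<dots> = (\<Prod>i<n. f i)"
    by (simp add: prod_list_diag_prod mat_diag_def atLeast0LessThan)
  finally show ?thesis .
qed

lemma minor_row_col_scaling:
  fixes A :: "'a::comm_ring_1 mat"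
  assumes "A \<in> carrier_mat d N" "I \<subseteq> {..<N}" "card I = d"
  shows "minor (mat d N (\<lambda>(i, j). r i * c j * A $$ (i, j))) I
    = (\<Prod>i<d. r i) * (\<Prod>j\<in>I. c j) * minor A I"
proof -
  define A' where "A' = mat d N (\<lambda>(i, j). r i * c j * A $$ (i, j))"
  note sA = submatrix_all_rows[OF assms(1,2), unfolded assms(3)]
  have A': "A' \<in> carrier_mat d N" by (simp add: A'_def)
  note sA' = submatrix_all_rows[OF A' assms(2), unfolded assms(3)]
  have "A' $$ (i, pick I j) = r i * c (pick I j) * A $$ (i, pick I j)" if "i < d" "j < d" for i j
    using that pick_less[OF assms(2)] assms(3) by (simp add: A'_def)
  then have "submatrix A' UNIV I = mat_diag d r * (submatrix A UNIV I * mat_diag d (\<lambda>j. c (pick I j)))"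
    by (intro eq_matI)
      (use sA(1) sA'(1) in
        \<open>auto simp: sA'(2) sA(2) mat_diag_mult_left[where nr = d] mat_diag_mult_right[where nr = d] mult_ac\<close>)
  moreover have "(\<Prod>j<d. c (pick I j)) = (\<Prod>j\<in>I. c j)"
    using prod.reindex_bij_betw[OF bij_betw_pick[OF finite_below[OF assms(2)]], of c] assms(3) by simp
  moreover have "submatrix A UNIV I * mat_diag d (\<lambda>j. c (pick I j)) \<in> carrier_mat d d"
    using sA(1) by simp
  ultimately show ?thesis unfolding minor_def A'_def[symmetric] using sA(1)
    by (simp add: det_mult[where n = d] det_mat_diag algebra_simps)
qed

lemma minor_of_int:
  assumes "A \<in> carrier_mat d N" "I \<subseteq> {..<N}" "card I = d"
  shows "minor (map_mat of_int A) I = (of_int (minor A I) :: 'a::comm_ring_1)"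
proof -
  have hom: "comm_ring_hom (of_int :: int \<Rightarrow> 'a)" by unfold_locales auto
  have A': "map_mat (of_int :: int \<Rightarrow> 'a) A \<in> carrier_mat d N" using assms by simp
  note sA = submatrix_all_rows[OF assms(1,2), unfolded assms(3)]
  note sA' = submatrix_all_rows[OF A' assms(2), unfolded assms(3)]
  have "submatrix (map_mat (of_int :: int \<Rightarrow> 'a) A) UNIV I = map_mat of_int (submatrix A UNIV I)"
    by (rule eq_matI) (use assms pick_less[OF assms(2)] sA(1) sA'(1) in \<open>auto simp: sA(2) sA'(2)\<close>)
  then show ?thesis by (simp add: minor_def comm_ring_hom.hom_det[OF hom])
qed

lemma left_inverse_if_unit_det:
  fixes M :: "'a::comm_ring_1 mat"
  assumes M: "M \<in> carrier_mat n n" and \<delta>: "\<delta> * det M = 1"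
  obtains P where "P \<in> carrier_mat n n" "P * M = 1\<^sub>m n"
proof (rule that[of "\<delta> \<cdot>\<^sub>m adj_mat M"])
  show "\<delta> \<cdot>\<^sub>m adj_mat M \<in> carrier_mat n n" using adj_mat(1)[OF M] by simp
  have "\<delta> \<cdot>\<^sub>m adj_mat M * M = \<delta> \<cdot>\<^sub>m (adj_mat M * M)"
    using mult_smult_assoc_mat[OF adj_mat(1)[OF M] M] by simp
  also have "\<dots> = 1\<^sub>m n" unfolding adj_mat(3)[OF M] using \<delta> by (auto intro!: eq_matI)
  finally show "\<delta> \<cdot>\<^sub>m adj_mat M * M = 1\<^sub>m n" .
qed

section \<open>Dependence of columns\<close>

text \<open>
  The set \<open>S\<close> of columns lies in a hyperplane of the \<open>d\<close>-dimensional space, the coefficients of the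
  hyperplane being \<open>y\<close>. Entries are given by a function so that no matrix has to be built for the
  combinatorial part of the argument.
\<close>

definition singular_on :: "nat \<Rightarrow> (nat \<Rightarrow> nat \<Rightarrow> 'a::field) \<Rightarrow> nat set \<Rightarrow> bool" where
  "singular_on d a S \<longleftrightarrow>
     (\<exists>y. (\<exists>i<d. y i \<noteq> 0) \<and> (\<forall>e\<in>S. (\<Sum>i<d. y i * a i e) = 0))"

text \<open>
  Right kernels of column submatrices and left kernels of matrices are both needed, with vectors
  indexed by column labels or by rows; the bijection \<open>\<pi>\<close> covers both uses.
\<close>

lemma kernel_vector_iff:
  fixes A :: "'a::comm_ring_1 mat"
  assumes A: "A \<in> carrier_mat k n" and \<pi>: "bij_betw \<pi> {..<n} S"
    and entry: "\<And>i j. i < k \<Longrightarrow> j < n \<Longrightarrow> A $$ (i, j) = h i (\<pi> j)"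
  shows "(\<exists>v\<in>carrier_vec n. v \<noteq> 0\<^sub>v n \<and> A *\<^sub>v v = 0\<^sub>v k) \<longleftrightarrow>
    (\<exists>y. (\<exists>e\<in>S. y e \<noteq> 0) \<and> (\<forall>i<k. (\<Sum>e\<in>S. y e * h i e) = 0))"
proof -
  have prod: "(A *\<^sub>v v) $ i = (\<Sum>e\<in>S. y e * h i e)"
    if "i < k" "v \<in> carrier_vec n" "\<And>j. j < n \<Longrightarrow> v $ j = y (\<pi> j)" for v y i
  proof -
    have "(A *\<^sub>v v) $ i = (\<Sum>j<n. y (\<pi> j) * h i (\<pi> j))"
      using A that by (auto simp: scalar_prod_def entry atLeast0LessThan mult.commute intro!: sum.cong)
    then show ?thesis using sum.reindex_bij_betw[OF \<pi>, of "\<lambda>e. y e * h i e"] by simp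
  qed
  show ?thesis
  proof
    assume "\<exists>v\<in>carrier_vec n. v \<noteq> 0\<^sub>v n \<and> A *\<^sub>v v = 0\<^sub>v k"
    then obtain v where v: "v \<in> carrier_vec n" "v \<noteq> 0\<^sub>v n" "A *\<^sub>v v = 0\<^sub>v k" by blast
    define y where "y e = v $ the_inv_into {..<n} \<pi> e" for e
    have y: "v $ j = y (\<pi> j)" if "j < n" for j
      using \<pi> that by (simp add: y_def bij_betw_def the_inv_into_f_f)
    obtain j where "j < n" "v $ j \<noteq> 0" using v(1,2) by (metis carrier_vecD eq_vecI index_zero_vec)
    then have "\<exists>e\<in>S. y e \<noteq> 0" using y \<pi> by (metis bij_betwE lessThan_iff)
    then show "\<exists>y. (\<exists>e\<in>S. y e \<noteq> 0) \<and> (\<forall>i<k. (\<Sum>e\<in>S. y e * h i e) = 0)"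
      using prod[OF _ v(1) y] v(3) by (intro exI[of _ y]) auto
  next
    assume "\<exists>y. (\<exists>e\<in>S. y e \<noteq> 0) \<and> (\<forall>i<k. (\<Sum>e\<in>S. y e * h i e) = 0)"
    then obtain y where y: "\<exists>e\<in>S. y e \<noteq> 0" "\<And>i. i < k \<Longrightarrow> (\<Sum>e\<in>S. y e * h i e) = 0" by blast
    define v where "v = vec n (y \<circ> \<pi>)"
    have v: "v \<in> carrier_vec n" "\<And>j. j < n \<Longrightarrow> v $ j = y (\<pi> j)" by (auto simp: v_def)
    obtain e where "e \<in> S" "y e \<noteq> 0" using y by blast
    then obtain j where "j < n" "v $ j \<noteq> 0" using v(2) \<pi> by (auto simp: bij_betw_def)
    then have "v \<noteq> 0\<^sub>v n" by auto
    moreover have "A *\<^sub>v v = 0\<^sub>v k"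
    proof (rule eq_vecI)
      fix i assume "i < dim_vec (0\<^sub>v k)"
      then show "(A *\<^sub>v v) $ i = 0\<^sub>v k $ i" using prod[OF _ v] y(2) by simp
    qed (use A in simp)
    ultimately show "\<exists>v\<in>carrier_vec n. v \<noteq> 0\<^sub>v n \<and> A *\<^sub>v v = 0\<^sub>v k" using v(1) by blast
  qed
qed

lemma minor_zero_iff_singular_on:
  fixes A :: "'a::field mat"
  assumes "A \<in> carrier_mat d N" "I \<subseteq> {..<N}" "card I = d"
  shows "minor A I = 0 \<longleftrightarrow> singular_on d (\<lambda>i j. A $$ (i, j)) I"
proof -
  note sA = submatrix_all_rows[OF assms(1,2), unfolded assms(3)]
  let ?M = "transpose_mat (submatrix A UNIV I)"
  have M: "?M \<in> carrier_mat d d" using sA(1) by simp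
  have "minor A I = 0 \<longleftrightarrow> (\<exists>v\<in>carrier_vec d. v \<noteq> 0\<^sub>v d \<and> ?M *\<^sub>v v = 0\<^sub>v d)"
    unfolding minor_def det_transpose[OF sA(1), symmetric] det_0_iff_vec_prod_zero_field[OF M] by blast
  also have "\<dots> \<longleftrightarrow> (\<exists>y. (\<exists>i\<in>{..<d}. y i \<noteq> 0) \<and> (\<forall>j<d. (\<Sum>i<d. y i * A $$ (i, pick I j)) = 0))"
    by (rule kernel_vector_iff[OF M, of "\<lambda>i. i"]) (use sA in \<open>auto simp: bij_betw_def\<close>)
  also have "\<dots> \<longleftrightarrow> singular_on d (\<lambda>i j. A $$ (i, j)) I"
    by (simp add: singular_on_def ball_pick[OF finite_below[OF assms(2)]] assms(3) lessThan_iff Bex_def)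
  finally show ?thesis .
qed

text \<open>
  Multiplying the row vector \<open>z\<close> times the submatrix by the adjugate gives \<open>z\<close> times the determinant.
  The entry \<open>z i = 1\<close> shows that \<open>p\<close> divides the minor, and of the three possible values only \<open>0\<close> is
  divisible by a non-unit.
\<close>

lemma minor_zero_if_annihilated_mod:
  fixes V :: "int mat"
  assumes V: "V \<in> carrier_mat d N" and S: "S \<subseteq> {..<N}" "card S = d"
    and unimod: "minor V S \<in> {-1, 0, 1}"
    and p: "\<not> is_unit p" and z: "i < d" "z i = 1"
    and dvd: "\<And>e. e \<in> S \<Longrightarrow> p dvd (\<Sum>k<d. z k * V $$ (k, e))"
  shows "minor V S = 0"
proof -
  note sV = submatrix_all_rows[OF V S(1), unfolded S(2)]
  let ?M = "submatrix V UNIV S"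
  note adj = adj_mat[OF sV(1)]
  have "(\<Sum>j<d. (\<Sum>k<d. z k * V $$ (k, pick S j)) * adj_mat ?M $$ (j, i))
      = (\<Sum>k<d. z k * (\<Sum>j<d. V $$ (k, pick S j) * adj_mat ?M $$ (j, i)))"
    unfolding sum_distrib_left sum_distrib_right by (subst sum.swap) (simp add: mult.assoc)
  also have "\<dots> = (\<Sum>k<d. z k * (if k = i then det ?M else 0))"
  proof (intro sum.cong refl arg_cong2[where f = "(*)"])
    fix k assume "k \<in> {..<d}"
    then have k: "k < d" by simp
    have "(\<Sum>j<d. V $$ (k, pick S j) * adj_mat ?M $$ (j, i)) = (?M * adj_mat ?M) $$ (k, i)"
      using k z(1) sV adj(1) by (auto simp: scalar_prod_def atLeast0LessThan intro!: sum.cong)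
    then show "(\<Sum>j<d. V $$ (k, pick S j) * adj_mat ?M $$ (j, i)) = (if k = i then det ?M else 0)"
      unfolding adj(2) using k z(1) by simp
  qed
  also have "\<dots> = minor V S" using z by (simp add: if_distrib sum.delta minor_def cong: if_cong)
  finally have expand: "(\<Sum>j<d. (\<Sum>k<d. z k * V $$ (k, pick S j)) * adj_mat ?M $$ (j, i)) = minor V S" .
  have "p dvd (\<Sum>j<d. (\<Sum>k<d. z k * V $$ (k, pick S j)) * adj_mat ?M $$ (j, i))"
    by (intro dvd_sum dvd_mult2 dvd) (simp add: pick_in_set_le S(2))
  then have "p dvd minor V S" unfolding expand .
  then show ?thesis using unimod p by auto
qed

lemma (in vec_space) exists_maximal_independent_columns:
  obtains U where "maximal U (\<lambda>T. T \<subseteq> set (cols A) \<and> lin_indpt T)"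
  using maximal_exists[of "(\<lambda>T. T \<subseteq> set (cols A) \<and> lin_indpt T)" "card (set (cols A))" "{}"]
  by (meson List.finite_set card_mono empty_iff empty_subsetI finite_lin_indpt2 rev_finite_subset)

lemma rank_deficient_iff_kernel:
  fixes A :: "'a::field mat"
  assumes A: "A \<in> carrier_mat m n"
  shows "vec_space.rank m A < n \<longleftrightarrow> (\<exists>v\<in>carrier_vec n. v \<noteq> 0\<^sub>v n \<and> A *\<^sub>v v = 0\<^sub>v m)"
proof -
  interpret vec_space "TYPE('a)" m .
  show ?thesis
  proof (cases "distinct (cols A)")
    case True
    have "rank A < n \<longleftrightarrow> lin_dep (set (cols A))"
      using lin_indpt_full_rank[OF A True] full_rank_lin_indpt[OF A _ True] rank_le_nc[OF A] by linarith
    also have "\<dots> \<longleftrightarrow> (\<exists>v\<in>carrier_vec n. v \<noteq> 0\<^sub>v n \<and> A *\<^sub>v v = 0\<^sub>v m)"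
    proof
      assume "lin_dep (set (cols A))"
      from lin_depE[OF A this True] show "\<exists>v\<in>carrier_vec n. v \<noteq> 0\<^sub>v n \<and> A *\<^sub>v v = 0\<^sub>v m"
        by blast
    qed (use lin_depI[OF A _ _ _ True] in blast)
    finally show ?thesis .
  next
    case False
    obtain S where S: "maximal S (\<lambda>T. T \<subseteq> set (cols A) \<and> lin_indpt T)"
      using exists_maximal_independent_columns .
    have "card S \<le> card (set (cols A))" using S by (simp add: card_mono maximal_def)
    also have "\<dots> < n" using False A by (metis card_distinct card_length carrier_matD(2) cols_length nat_less_le)
    finally have "rank A < n" using rank_card_indpt[OF A S] by simp
    moreover obtain i j where ij: "i < n" "j < n" "i \<noteq> j" "col A i = col A j"
      using False A by (auto simp: distinct_conv_nth)
    (* The rank counts the set of columns, so a repeated column needs its own kernel vector. *)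
    define v where "v = vec n (\<lambda>k. if k = i then 1 else if k = j then - 1 else (0::'a))"
    have "v \<noteq> 0\<^sub>v n" using ij by (auto simp: v_def vec_eq_iff)
    moreover have "A *\<^sub>v v = 0\<^sub>v m"
    proof (rule eq_vecI)
      fix r assume "r < dim_vec (0\<^sub>v m)"
      then have r: "r < m" by simp
      have "A $$ (r, i) = A $$ (r, j)" using ij A r by (metis carrier_matD index_col)
      moreover have "(A *\<^sub>v v) $ r = (\<Sum>k\<in>{0..<n}. A $$ (r, k) * v $ k)"
        using A r by (auto simp: scalar_prod_def v_def intro!: sum.cong)
      moreover have "\<dots> = (\<Sum>k\<in>{i, j}. A $$ (r, k) * v $ k)"
        by (rule sum.mono_neutral_right) (use ij in \<open>auto simp: v_def\<close>)
      moreover have "\<dots> = A $$ (r, i) - A $$ (r, j)" using ij(1-3) by (simp add: v_def)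
      ultimately show "(A *\<^sub>v v) $ r = 0\<^sub>v m $ r" using r by simp
    qed (use A in simp)
    moreover have "v \<in> carrier_vec n" by (simp add: v_def)
    ultimately show ?thesis by blast
  qed
qed

definition columns_dependent :: "'a::field mat \<Rightarrow> nat set \<Rightarrow> nat set \<Rightarrow> bool" where
  "columns_dependent A R S \<longleftrightarrow>
     (\<exists>v. (\<exists>e\<in>S. v e \<noteq> 0) \<and> (\<forall>r\<in>R. (\<Sum>e\<in>S. v e * A $$ (r, e)) = 0))"

lemma rank_deficient_iff_dependent:
  fixes A :: "'a::field mat"
  assumes "A \<in> carrier_mat m N" "S \<subseteq> {..<N}"
  shows "vec_space.rank m (submatrix A UNIV S) < card S \<longleftrightarrow> columns_dependent A {..<m} S"
  unfolding rank_deficient_iff_kernel[OF submatrix_all_rows(1)[OF assms]] columns_dependent_def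
  by (subst kernel_vector_iff[OF submatrix_all_rows(1)[OF assms] bij_betw_pick[OF finite_below[OF assms(2)]]
        submatrix_all_rows(2)[OF assms]]) auto

lemma det_zero_iff_dependent:
  fixes A :: "'a::field mat"
  assumes "A \<in> carrier_mat m N" "R \<subseteq> {..<m}" "S \<subseteq> {..<N}" "card R = card S"
  shows "det (submatrix A R S) = 0 \<longleftrightarrow> columns_dependent A R S"
proof -
  note sA = submatrix_within[OF assms(1-3), unfolded assms(4)]
  have "det (submatrix A R S) = 0 \<longleftrightarrow>
      (\<exists>v\<in>carrier_vec (card S). v \<noteq> 0\<^sub>v (card S) \<and> submatrix A R S *\<^sub>v v = 0\<^sub>v (card S))"
    unfolding det_0_iff_vec_prod_zero_field[OF sA(1)] by blast
  also have "\<dots> \<longleftrightarrow> (\<exists>y. (\<exists>e\<in>S. y e \<noteq> 0) \<and> (\<forall>i<card S. (\<Sum>e\<in>S. y e * A $$ (pick R i, e)) = 0))"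
    by (rule kernel_vector_iff[OF sA(1) bij_betw_pick[OF finite_below[OF assms(3)]] sA(2)])
  also have "\<dots> \<longleftrightarrow> columns_dependent A R S"
    by (simp add: columns_dependent_def ball_pick[OF finite_below[OF assms(2)]] assms(4))
  finally show ?thesis .
qed

section \<open>A unimodular integer model of a regular matroid\<close>

text \<open>
  Over the reals the Gram matrix of independent columns is nonsingular. Each of its rows is a linear
  combination of rows of the given matrix, so by multilinearity its determinant is a combination of
  determinants of \<open>n\<close> chosen rows; one of these is nonzero, and its rows are distinct.
\<close>

lemma exists_nonsingular_rows:
  fixes A :: "real mat"
  assumes A: "A \<in> carrier_mat m N" and S: "S \<subseteq> {..<N}" and indep: "\<not> columns_dependent A {..<m} S"
  obtains R where "R \<subseteq> {..<m}" "card R = card S" "det (submatrix A R S) \<noteq> 0"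
proof -
  define n where "n = card S"
  define M where "M = submatrix A UNIV S"
  note sA = submatrix_all_rows[OF A S, folded n_def M_def]
  have no_kernel: "v = 0\<^sub>v n" if "v \<in> carrier_vec n" "M *\<^sub>v v = 0\<^sub>v m" for v
    using indep that rank_deficient_iff_kernel[OF sA(1)]
    unfolding rank_deficient_iff_dependent[OF A S, folded n_def M_def, symmetric] by blast
  define G where "G = transpose_mat M * M"
  have G: "G \<in> carrier_mat n n" using sA(1) by (simp add: G_def)
  have "det G \<noteq> 0"
  proof
    assume "det G = 0"
    then obtain v where v: "v \<in> carrier_vec n" "v \<noteq> 0\<^sub>v n" "G *\<^sub>v v = 0\<^sub>v n"
      unfolding det_0_iff_vec_prod_zero_field[OF G] by blast
    define x where "x = M *\<^sub>v v"
    have x: "x \<in> carrier_vec m" using mult_mat_vec_carrier[OF sA(1) v(1)] by (simp add: x_def)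
    have "transpose_mat M *\<^sub>v x = 0\<^sub>v n"
      using v(1,3) sA(1) by (simp add: x_def G_def assoc_mult_mat_vec[of _ n m _ n])
    then have "x \<bullet> x = 0"
      using transpose_vec_mult_scalar[OF sA(1) v(1) x] v(1) by (simp add: x_def)
    then have "(\<Sum>i\<in>{0..<m}. x $ i * x $ i) = 0" using x by (simp add: scalar_prod_def)
    then have "x $ i = 0" if "i < m" for i
      using that by (subst (asm) sum_nonneg_eq_0_iff) auto
    then have "x = 0\<^sub>v m" using x by auto
    then show False using no_kernel v(1,2) by (simp add: x_def)
  qed
  (* g i k is the contribution of row k of M to row i of the Gram matrix. *)
  define g where "g i k = M $$ (k, i) \<cdot>\<^sub>v row M k" for i k
  have "G = mat\<^sub>r n n (\<lambda>i. finsum_vec TYPE(real) n (g i) {0..<m})"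
  proof (rule eq_matI)
    fix i j assume "i < dim_row (mat\<^sub>r n n (\<lambda>i. finsum_vec TYPE(real) n (g i) {0..<m}))"
      "j < dim_col (mat\<^sub>r n n (\<lambda>i. finsum_vec TYPE(real) n (g i) {0..<m}))"
    then have ij: "i < n" "j < n" by auto
    have "finsum_vec TYPE(real) n (g i) {0..<m} $ j = (\<Sum>k\<in>{0..<m}. g i k $ j)"
      by (rule index_finsum_vec) (use ij sA(1) in \<open>auto simp: g_def\<close>)
    then show "G $$ (i, j) = mat\<^sub>r n n (\<lambda>i. finsum_vec TYPE(real) n (g i) {0..<m}) $$ (i, j)"
      using ij sA(1) by (auto simp: G_def g_def scalar_prod_def intro!: sum.cong)
  qed (use G in auto)
  then have "det G = (\<Sum>f | (\<forall>i\<in>{0..<n}. f i \<in> {0..<m}) \<and> (\<forall>i. i \<notin> {0..<n} \<longrightarrow> f i = i).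
      det (mat\<^sub>r n n (\<lambda>i. g i (f i))))"
    using sA(1) by (subst det_linear_rows_sum[symmetric]) (auto simp: g_def)
  with \<open>det G \<noteq> 0\<close> obtain f where "f \<in> {f. (\<forall>i\<in>{0..<n}. f i \<in> {0..<m}) \<and> (\<forall>i. i \<notin> {0..<n} \<longrightarrow> f i = i)}"
    and "det (mat\<^sub>r n n (\<lambda>i. g i (f i))) \<noteq> 0"
    using sum.not_neutral_contains_not_neutral by (metis (no_types, lifting))
  moreover from this(1) have f: "f i < m" if "i < n" for i using that by simp
  moreover define K where "K = mat\<^sub>r n n (\<lambda>i. row M (f i))"
  ultimately have detK: "det K \<noteq> 0"
    using sA(1) unfolding g_def by (subst (asm) det_rows_mul) auto
  have K: "K \<in> carrier_mat n n" by (simp add: K_def)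
  have rowK: "row K i = row M (f i)" if "i < n" for i
    using that sA(1) by (simp add: K_def)
  have inj: "inj_on f {..<n}"
  proof (rule inj_onI)
    fix i j assume "i \<in> {..<n}" "j \<in> {..<n}" "f i = f j"
    then show "i = j" using det_identical_rows[OF K, of i j] detK rowK by auto
  qed
  show thesis
  proof
    show R: "f ` {..<n} \<subseteq> {..<m}" using f by auto
    show card: "card (f ` {..<n}) = card S" using inj by (simp add: card_image n_def)
    show "det (submatrix A (f ` {..<n}) S) \<noteq> 0"
    proof
      assume "det (submatrix A (f ` {..<n}) S) = 0"
      then have "\<exists>y. (\<exists>e\<in>S. y e \<noteq> 0) \<and> (\<forall>i<n. (\<Sum>e\<in>S. y e * A $$ (f i, e)) = 0)"
        unfolding det_zero_iff_dependent[OF A R S card] columns_dependent_def by fastforce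
      moreover have "K $$ (i, j) = A $$ (f i, pick S j)" if "i < n" "j < n" for i j
        using that sA f by (simp add: K_def)
      ultimately have "\<exists>v\<in>carrier_vec n. v \<noteq> 0\<^sub>v n \<and> K *\<^sub>v v = 0\<^sub>v n"
        using kernel_vector_iff[OF K bij_betw_pick[OF finite_below[OF S], folded n_def],
            of "\<lambda>i e. A $$ (f i, e)"] by simp
      then show False using detK unfolding det_0_iff_vec_prod_zero_field[OF K] by blast
    qed
  qed
qed

lemma independent_columns_le_rank:
  fixes A :: "real mat"
  assumes A: "A \<in> carrier_mat m N" and S: "S \<subseteq> {..<N}" and indep: "\<not> columns_dependent A {..<m} S"
  shows "card S \<le> vec_space.rank m A"
proof -
  obtain R where "det (submatrix A R S) \<noteq> 0" using exists_nonsingular_rows[OF assms] .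
  moreover have "{j. j < N \<and> j \<in> S} = S" using S by auto
  ultimately show ?thesis using vec_space.rank_gt_minor[OF A] by metis
qed

lemma exists_column_basis:
  fixes A :: "'a::field mat"
  assumes A: "A \<in> carrier_mat m N"
  obtains B where "B \<subseteq> {..<N}" "card B = vec_space.rank m A"
    "vec_space.rank m (submatrix A UNIV B) = card B"
proof -
  interpret vec_space "TYPE('a)" m .
  obtain U where U: "maximal U (\<lambda>T. T \<subseteq> set (cols A) \<and> lin_indpt T)"
    using exists_maximal_independent_columns .
  have "set (cols A) = col A ` {..<N}" using A by (simp add: cols_def atLeast0LessThan)
  moreover have "U \<subseteq> set (cols A)" using U unfolding maximal_def by blast
  ultimately have "U \<subseteq> col A ` {..<N}" by simp
  then obtain B where B: "B \<subseteq> {..<N}" "inj_on (col A) B" "U = col A ` B"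
    by (metis subset_image_inj)
  note sA = submatrix_all_rows[OF A B(1)]
  have col_eq: "col (submatrix A UNIV B) j = col A (pick B j)" if "j < card B" for j
    using that sA A pick_less[OF B(1) that] by (intro eq_vecI) auto
  have bij: "bij_betw (pick B) {..<card B} B" by (rule bij_betw_pick[OF finite_below[OF B(1)]])
  have "cols (submatrix A UNIV B) = map (\<lambda>j. col A (pick B j)) [0..<card B]"
    using sA(1) col_eq by (auto simp: cols_def)
  moreover have "inj_on (\<lambda>j. col A (pick B j)) {..<card B}"
    using comp_inj_on[of "pick B" "{..<card B}" "col A"] bij B(2) by (simp add: bij_betw_def comp_def)
  moreover have "(\<lambda>j. col A (pick B j)) ` {..<card B} = U"
    using bij_betw_imp_surj_on[OF bij] B(3) by (metis image_image)
  ultimately have "distinct (cols (submatrix A UNIV B))" "set (cols (submatrix A UNIV B)) = U"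
    by (auto simp: distinct_map atLeast0LessThan)
  then have "rank (submatrix A UNIV B) = card B"
    using lin_indpt_full_rank[OF sA(1)] U by (simp add: maximal_def)
  moreover have "card B = rank A"
    using rank_card_indpt[OF A U] B by (simp add: card_image)
  ultimately show thesis using that[OF B(1)] by simp
qed

lemma submatrix_all_columns:
  assumes "A \<in> carrier_mat m N"
  shows "submatrix A UNIV {..<N} = A"
proof -
  have "pick {..<N} j = j" if "j < N" for j
  proof -
    have "{a \<in> {..<N}. a < j} = {..<j}" using that by auto
    then show ?thesis using pick_card_in_set[of j "{..<N}"] that by simp
  qed
  then show ?thesis using submatrix_all_rows[OF assms, of "{..<N}"] assms by (intro eq_matI) auto
qed

lemma minor_zero_iff_rank:
  fixes A :: "'a::field mat"
  assumes "A \<in> carrier_mat d N" "I \<subseteq> {..<N}" "card I = d"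
  shows "minor A I = 0 \<longleftrightarrow> vec_space.rank d (submatrix A UNIV I) < d"
  using vec_space.det_rank_iff vec_space.rank_le_nc submatrix_all_rows(1)[OF assms(1,2)] assms(3)
  unfolding minor_def by (metis nat_less_le)

text \<open>
  Otherwise \<open>e\<close> together with \<open>B\<close> would be more independent columns than the rank allows.
\<close>

lemma columns_in_span_of_basis:
  fixes A :: "real mat"
  assumes A: "A \<in> carrier_mat m N" and B: "B \<subseteq> {..<N}" "\<not> columns_dependent A {..<m} B"
    and rank: "vec_space.rank m A = card B" and e: "e < N"
  obtains c where "\<And>r. r < m \<Longrightarrow> A $$ (r, e) = (\<Sum>b\<in>B. c b * A $$ (r, b))"
proof (cases "e \<in> B")
  case True
  show thesis
  proof
    fix r
    have "(\<Sum>b\<in>B. (if b = e then 1 else 0) * A $$ (r, b)) = (\<Sum>b\<in>{e}. A $$ (r, b))"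
      by (rule sum.mono_neutral_cong_right) (use True finite_below[OF B(1)] in auto)
    then show "A $$ (r, e) = (\<Sum>b\<in>B. (if b = e then 1 else 0) * A $$ (r, b))" by simp
  qed
next
  case False
  have fin: "finite B" using finite_below[OF B(1)] .
  have "columns_dependent A {..<m} (insert e B)"
    using independent_columns_le_rank[OF A, of "insert e B"] B(1) e rank False fin by fastforce
  then obtain v where v: "\<exists>x\<in>insert e B. v x \<noteq> 0"
    "\<And>r. r < m \<Longrightarrow> (\<Sum>x\<in>insert e B. v x * A $$ (r, x)) = 0"
    unfolding columns_dependent_def by auto
  have v_sum: "v e * A $$ (r, e) + (\<Sum>b\<in>B. v b * A $$ (r, b)) = 0" if "r < m" for r
    using v(2)[OF that] False fin by simp
  have "v e \<noteq> 0"
  proof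
    assume "v e = 0"
    then have "columns_dependent A {..<m} B"
      unfolding columns_dependent_def using v(1) v_sum by (intro exI[of _ v]) auto
    then show False using B(2) by simp
  qed
  show thesis
  proof
    fix r assume r: "r < m"
    have "A $$ (r, e) = - (\<Sum>b\<in>B. v b * A $$ (r, b)) / v e"
      using v_sum[OF r] \<open>v e \<noteq> 0\<close> by (simp add: field_simps)
    also have "\<dots> = (\<Sum>b\<in>B. - v b / v e * A $$ (r, b))"
      by (simp add: sum_divide_distrib sum_negf)
    finally show "A $$ (r, e) = (\<Sum>b\<in>B. - v b / v e * A $$ (r, b))" .
  qed
qed

text \<open>
  All columns are combinations of the columns in \<open>B\<close>, and these stay independent when only the rows
  in \<open>R\<close> are kept. So a combination of columns that vanishes on \<open>R\<close> vanishes on all rows. This makes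
  one choice of rows work for all column sets at once.
\<close>

lemma dependent_on_basis_rows:
  fixes A :: "real mat"
  assumes A: "A \<in> carrier_mat m N" and B: "B \<subseteq> {..<N}" "\<not> columns_dependent A R B"
    and R: "R \<subseteq> {..<m}" and rank: "vec_space.rank m A = card B" and I: "I \<subseteq> {..<N}"
  shows "columns_dependent A R I \<longleftrightarrow> columns_dependent A {..<m} I"
proof
  assume "columns_dependent A R I"
  then obtain v where v: "\<exists>e\<in>I. v e \<noteq> 0" "\<And>r. r \<in> R \<Longrightarrow> (\<Sum>e\<in>I. v e * A $$ (r, e)) = 0"
    unfolding columns_dependent_def by blast
  have indep: "\<not> columns_dependent A {..<m} B"
    using B(2) R unfolding columns_dependent_def by blast
  have "\<exists>c. \<forall>r<m. A $$ (r, e) = (\<Sum>b\<in>B. c b * A $$ (r, b))" if "e \<in> I" for e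
    using columns_in_span_of_basis[OF A B(1) indep rank, of e] that I by blast
  then obtain c where c: "\<And>e r. e \<in> I \<Longrightarrow> r < m \<Longrightarrow> A $$ (r, e) = (\<Sum>b\<in>B. c e b * A $$ (r, b))"
    by metis
  define y where "y b = (\<Sum>e\<in>I. v e * c e b)" for b
  have transfer: "(\<Sum>e\<in>I. v e * A $$ (r, e)) = (\<Sum>b\<in>B. y b * A $$ (r, b))" if "r < m" for r
  proof -
    have "(\<Sum>e\<in>I. v e * A $$ (r, e)) = (\<Sum>e\<in>I. \<Sum>b\<in>B. v e * c e b * A $$ (r, b))"
      by (rule sum.cong) (use c that in \<open>auto simp: sum_distrib_left mult.assoc\<close>)
    also have "\<dots> = (\<Sum>b\<in>B. y b * A $$ (r, b))"
      unfolding y_def sum_distrib_right by (rule sum.swap)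
    finally show ?thesis .
  qed
  have "(\<Sum>b\<in>B. y b * A $$ (r, b)) = 0" if "r \<in> R" for r
    using transfer[of r] v(2)[OF that] R that by auto
  then have "\<forall>b\<in>B. y b = 0" using B(2) unfolding columns_dependent_def by blast
  then have "(\<Sum>e\<in>I. v e * A $$ (r, e)) = 0" if "r < m" for r
    using transfer[OF that] by simp
  then show "columns_dependent A {..<m} I" using v(1) unfolding columns_dependent_def by auto
next
  assume "columns_dependent A {..<m} I"
  then show "columns_dependent A R I" using R unfolding columns_dependent_def by blast
qed

lemma totally_unimodular_entry:
  assumes T: "T \<in> carrier_mat m N" "totally_unimodular T" and rj: "r < m" "j < N"
  shows "T $$ (r, j) \<in> {-1, 0, 1}"
proof -
  have "det (submatrix T {r} {j}) \<in> {-1, 0, 1}"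
    using T rj by (auto simp: totally_unimodular_def)
  moreover have s: "submatrix T {r} {j} \<in> carrier_mat 1 1"
    using submatrix_within(1)[OF T(1), of "{r}" "{j}"] rj by simp
  moreover have "submatrix T {r} {j} $$ (0, 0) = T $$ (r, j)"
    using submatrix_within(2)[OF T(1), of "{r}" "{j}" 0 0] rj
      pick_in_set_le[of 0 "{r}"] pick_in_set_le[of 0 "{j}"] by simp
  ultimately show ?thesis using det_single[of "submatrix T {r} {j}"] s by auto
qed

text \<open>
  The model \<open>V\<close> consists of those rows of a totally unimodular representation that are picked out
  by one column basis \<open>B\<close>; its maximal minors are minors of the representation.
\<close>

lemma unimodular_model:
  fixes X :: "'a::field mat"
  assumes X: "X \<in> carrier_mat d N" and rank_X: "vec_space.rank d X = d"
    and regular: "regular_matroid (matroid_of X)"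
  obtains V :: "int mat" and B where "V \<in> carrier_mat d N"
    and "\<And>I. I \<subseteq> {..<N} \<Longrightarrow> card I = d \<Longrightarrow> minor V I \<in> {-1, 0, 1}"
    and "\<And>I. I \<subseteq> {..<N} \<Longrightarrow> card I = d \<Longrightarrow> minor V I = 0 \<longleftrightarrow> minor X I = 0"
    and "B \<subseteq> {..<N}" "card B = d" "minor X B \<noteq> 0"
proof -
  obtain T :: "real mat" where TU: "totally_unimodular T" and same: "matroid_of T = matroid_of X"
    using regular unfolding regular_matroid_def by blast
  define m where "m = dim_row T"
  have "{..<dim_col T} = {..<N}" using same X by (simp add: matroid_of_def)
  then have T: "T \<in> carrier_mat m N" by (auto simp: m_def)
  have rank_eq: "vec_space.rank m (submatrix T UNIV S) = vec_space.rank d (submatrix X UNIV S)"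
    if "S \<subseteq> {..<N}" for S
  proof -
    have "snd (matroid_of T) S = snd (matroid_of X) S" using same by simp
    then show ?thesis using that T X by (simp add: matroid_of_def)
  qed
  have rank_T: "vec_space.rank m T = d"
    using rank_eq[of "{..<N}"] submatrix_all_columns[OF T] submatrix_all_columns[OF X] rank_X by simp
  have dep_iff: "columns_dependent T {..<m} I \<longleftrightarrow> minor X I = 0" if "I \<subseteq> {..<N}" "card I = d" for I
    unfolding rank_deficient_iff_dependent[OF T that(1), symmetric] minor_zero_iff_rank[OF X that]
    using rank_eq[OF that(1)] that(2) by simp
  obtain B where B: "B \<subseteq> {..<N}" "card B = d" "vec_space.rank d (submatrix X UNIV B) = d"
    using exists_column_basis[OF X] rank_X by metis
  then have minor_B: "minor X B \<noteq> 0" using minor_zero_iff_rank[OF X B(1,2)] by simp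
  then have "\<not> columns_dependent T {..<m} B" using dep_iff B by simp
  then obtain R where R: "R \<subseteq> {..<m}" "card R = card B" "det (submatrix T R B) \<noteq> 0"
    using exists_nonsingular_rows[OF T B(1)] by metis
  have indep: "\<not> columns_dependent T R B" using det_zero_iff_dependent[OF T R(1) B(1) R(2)] R(3) by simp
  have det_iff: "det (submatrix T R I) = 0 \<longleftrightarrow> minor X I = 0" if "I \<subseteq> {..<N}" "card I = d" for I
    using det_zero_iff_dependent[OF T R(1) that(1)] dependent_on_basis_rows[OF T B(1) indep R(1) _ that(1)]
      dep_iff[OF that] rank_T R(2) B(2) that(2) by simp
  (* The entries of T are -1, 0 and 1, so rounding down only changes their type. *)
  define V where "V = mat d N (\<lambda>(i, j). \<lfloor>T $$ (pick R i, j)\<rfloor>)"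
  have V: "V \<in> carrier_mat d N" by (simp add: V_def)
  have V_minor: "of_int (minor V I) = det (submatrix T R I)" if I: "I \<subseteq> {..<N}" "card I = d" for I
  proof -
    note sV = submatrix_all_rows[OF V I(1), unfolded I(2)]
    note sT = submatrix_within[OF T R(1) I(1), unfolded R(2) B(2) I(2)]
    have "map_mat of_int (submatrix V UNIV I) = submatrix T R I"
    proof (rule eq_matI)
      fix i j assume "i < dim_row (submatrix T R I)" "j < dim_col (submatrix T R I)"
      then have ij: "i < d" "j < d" using sT(1) by auto
      have p: "pick R i < m" "pick I j < N" using pick_less R I B(2) ij by auto
      then have "T $$ (pick R i, pick I j) \<in> {-1, 0, 1}" by (rule totally_unimodular_entry[OF T TU])
      then have "T $$ (pick R i, pick I j) \<in> \<int>" by auto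
      then have "of_int \<lfloor>T $$ (pick R i, pick I j)\<rfloor> = T $$ (pick R i, pick I j)"
        by (metis Ints_cases floor_of_int)
      then show "map_mat of_int (submatrix V UNIV I) $$ (i, j) = submatrix T R I $$ (i, j)"
        using ij p sV sT by (simp add: V_def)
    qed (use sV(1) sT(1) in auto)
    then show ?thesis unfolding minor_def by (metis of_int_hom.hom_det)
  qed
  have "minor V I \<in> {-1, 0, 1}" if I: "I \<subseteq> {..<N}" "card I = d" for I
  proof -
    have "det (submatrix T R I) \<in> {-1, 0, 1}"
      using TU R(1,2) I B(2) T unfolding totally_unimodular_def by (metis carrier_matD)
    then have "real_of_int (minor V I) \<in> {-1, 0, 1}" by (simp add: V_minor[OF I])
    then show ?thesis by auto
  qed
  moreover have "minor V I = 0 \<longleftrightarrow> minor X I = 0" if "I \<subseteq> {..<N}" "card I = d" for I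
    using V_minor[OF that] det_iff[OF that] by (metis of_int_eq_0_iff)
  ultimately show thesis using that[OF V _ _ B(1,2) minor_B] by blast
qed

section \<open>Annihilators of chordless paths\<close>

lemma sum_two_neighbours:
  fixes g :: "nat \<Rightarrow> 'a::comm_monoid_add"
  assumes "t < m" and "\<And>s. s \<le> m \<Longrightarrow> s \<noteq> t \<Longrightarrow> s \<noteq> Suc t \<Longrightarrow> g s = 0"
  shows "(\<Sum>s\<le>m. g s) = g t + g (Suc t)"
proof -
  have "(\<Sum>s\<le>m. g s) = (\<Sum>s\<in>{t, Suc t}. g s)"
    by (rule sum.mono_neutral_right) (use assms in auto)
  then show ?thesis by simp
qed

lemma sum_two_ends:
  fixes g :: "nat \<Rightarrow> 'a::comm_monoid_add"
  assumes "0 < m" and "\<And>s. 0 < s \<Longrightarrow> s < m \<Longrightarrow> g s = 0"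
  shows "(\<Sum>s\<le>m. g s) = g 0 + g m"
proof -
  have "(\<Sum>s\<le>m. g s) = (\<Sum>s\<in>{0, m}. g s)"
    by (rule sum.mono_neutral_right) (use assms in auto)
  then show ?thesis using assms(1) by simp
qed

text \<open>
  Coefficients of the row vector that is \<open>1\<close> at the start of a path and annihilates the columns of
  the path. Column \<open>q s\<close> meets only the rows \<open>f s\<close> and \<open>f (Suc s)\<close>, in units, so that dividing by
  an entry is the same as multiplying by it.
\<close>

primrec path_sign :: "(nat \<Rightarrow> nat \<Rightarrow> int) \<Rightarrow> (nat \<Rightarrow> nat) \<Rightarrow> (nat \<Rightarrow> nat) \<Rightarrow> nat \<Rightarrow> int" where
  "path_sign u f q 0 = 1"
| "path_sign u f q (Suc s) = - path_sign u f q s * u (f s) (q s) * u (f (Suc s)) (q s)"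

text \<open>
  A path through the rows \<open>f 0, \<dots>, f m\<close> in which column \<open>q t\<close> joins row \<open>f t\<close> to row \<open>f (Suc t)\<close>,
  closed to a cycle by the column \<open>e\<close>, with no other nonzero entries of these columns in these rows.
\<close>

locale chordless_path =
  fixes u :: "nat \<Rightarrow> nat \<Rightarrow> int" and f q :: "nat \<Rightarrow> nat" and m e d :: nat
  assumes m_pos: "0 < m"
    and inj_f: "inj_on f {..m}"
    and f_less: "s \<le> m \<Longrightarrow> f s < d"
    and edges: "t < m \<Longrightarrow> u (f t) (q t) \<in> {-1, 1}" "t < m \<Longrightarrow> u (f (Suc t)) (q t) \<in> {-1, 1}"
    and chordless: "s \<le> m \<Longrightarrow> t < m \<Longrightarrow> s \<noteq> t \<Longrightarrow> s \<noteq> Suc t \<Longrightarrow> u (f s) (q t) = 0"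
    and ends: "u (f 0) e \<in> {-1, 1}" "u (f m) e \<in> {-1, 1}"
    and interior: "0 < s \<Longrightarrow> s < m \<Longrightarrow> u (f s) e = 0"
begin

abbreviation "\<sigma> \<equiv> path_sign u f q"

lemma sign_unit: "s \<le> m \<Longrightarrow> \<sigma> s \<in> {-1, 1}"
proof (induction s)
  case (Suc s)
  then show ?case using edges[of s] by auto
qed simp

lemma sum_over_path:
  fixes y :: "nat \<Rightarrow> 'b::comm_ring_1"
  assumes "\<And>i. i < d \<Longrightarrow> i \<notin> f ` {..m} \<Longrightarrow> y i = 0"
  shows "(\<Sum>i<d. y i * h i) = (\<Sum>s\<le>m. y (f s) * h (f s))"
proof -
  have "(\<Sum>i<d. y i * h i) = (\<Sum>i\<in>f ` {..m}. y i * h i)"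
    by (rule sum.mono_neutral_right) (use assms f_less in auto)
  then show ?thesis by (simp add: sum.reindex[OF inj_f])
qed

text \<open>
  The equations of the path columns determine \<open>y\<close> from its value at the start, and the
  equation of column \<open>e\<close> then relates the two ends. The factors \<open>r\<close> and \<open>c\<close> allow for rows and
  columns scaled relative to \<open>u\<close>, and \<open>w\<close> is the ratio left over in column \<open>e\<close>; with all three
  equal to \<open>1\<close> the lemma speaks about \<open>u\<close> itself.
\<close>

lemma annihilator_on_path:
  fixes a :: "nat \<Rightarrow> nat \<Rightarrow> 'b::field"
  assumes supp: "\<And>i. i < d \<Longrightarrow> i \<notin> f ` {..m} \<Longrightarrow> y i = 0"
    and nz: "\<exists>i<d. y i \<noteq> 0"
    and scaled: "\<And>s t. s \<le> m \<Longrightarrow> t < m \<Longrightarrow> a (f s) (q t) = r (f s) * c (q t) * of_int (u (f s) (q t))"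
    and c: "\<And>t. t < m \<Longrightarrow> c (q t) \<noteq> 0"
    and r: "\<And>s. s \<le> m \<Longrightarrow> r (f s) \<noteq> 0"
    and kill: "\<And>t. t < m \<Longrightarrow> (\<Sum>i<d. y i * a i (q t)) = 0"
    and kill_e: "(\<Sum>i<d. y i * a i e) = 0"
    and ratio: "\<And>s. s \<le> m \<Longrightarrow> a (f s) e = w (f s) * r (f s) * of_int (u (f s) e)"
  shows "w (f 0) * of_int (u (f 0) e) = - of_int (\<sigma> m) * (w (f m) * of_int (u (f m) e))"
proof -
  have propagate: "y (f s) * r (f s) = y (f 0) * r (f 0) * of_int (\<sigma> s)" if "s \<le> m" for s
    using that
  proof (induction s)
    case (Suc s)
    have "0 = (\<Sum>k\<le>m. y (f k) * a (f k) (q s))"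
      using kill[of s] sum_over_path[where y = y and h = "\<lambda>i. a i (q s)"] supp Suc.prems by simp
    also have "\<dots> = y (f s) * a (f s) (q s) + y (f (Suc s)) * a (f (Suc s)) (q s)"
      by (rule sum_two_neighbours) (use Suc.prems scaled chordless in auto)
    also have "\<dots> = c (q s) * (y (f s) * r (f s) * of_int (u (f s) (q s))
        + y (f (Suc s)) * r (f (Suc s)) * of_int (u (f (Suc s)) (q s)))"
      using Suc.prems by (simp add: scaled algebra_simps)
    finally have "y (f s) * r (f s) * of_int (u (f s) (q s))
        + y (f (Suc s)) * r (f (Suc s)) * of_int (u (f (Suc s)) (q s)) = 0"
      using c[of s] Suc.prems by simp
    then have "y (f (Suc s)) * r (f (Suc s)) * of_int (u (f (Suc s)) (q s))
        = - (y (f s) * r (f s) * of_int (u (f s) (q s)))"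
      by (simp add: add_eq_0_iff)
    then have "y (f (Suc s)) * r (f (Suc s)) * (of_int (u (f (Suc s)) (q s)) * of_int (u (f (Suc s)) (q s)))
        = - (y (f s) * r (f s)) * of_int (u (f s) (q s)) * of_int (u (f (Suc s)) (q s))"
      by (simp flip: mult.assoc)
    moreover have "of_int (u (f (Suc s)) (q s)) * of_int (u (f (Suc s)) (q s)) = (1::'b)"
      using edges(2)[of s] Suc.prems by auto
    ultimately show ?case using Suc by (simp add: mult.assoc)
  qed simp
  have y0: "y (f 0) \<noteq> 0"
  proof
    assume "y (f 0) = 0"
    then have "y (f s) = 0" if "s \<le> m" for s using propagate[OF that] r[OF that] by simp
    then show False using supp nz by blast
  qed
  have "0 = (\<Sum>s\<le>m. y (f s) * a (f s) e)"
    using kill_e sum_over_path[where y = y and h = "\<lambda>i. a i e"] supp by simp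
  also have "\<dots> = y (f 0) * a (f 0) e + y (f m) * a (f m) e"
    by (rule sum_two_ends) (use m_pos interior ratio in auto)
  also have "\<dots> = (y (f 0) * r (f 0)) * (w (f 0) * of_int (u (f 0) e))
       + (y (f m) * r (f m)) * (w (f m) * of_int (u (f m) e))"
    by (simp add: ratio algebra_simps)
  also have "\<dots> = (y (f 0) * r (f 0)) * (w (f 0) * of_int (u (f 0) e)
       + of_int (\<sigma> m) * (w (f m) * of_int (u (f m) e)))"
    using propagate[of m] by (simp add: algebra_simps)
  finally show ?thesis using y0 r[of 0] by (simp add: add_eq_0_iff2)
qed

text \<open>
  The product with column \<open>e\<close> is a sum of two units, hence even.
\<close>

lemma sign_vector:
  obtains z where "z (f 0) = 1"
    and "\<And>i. i \<notin> f ` {..m} \<Longrightarrow> z i = (0::int)"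
    and "\<And>t. t < m \<Longrightarrow> (\<Sum>i<d. z i * u i (q t)) = 0"
    and "even (\<Sum>i<d. z i * u i e)"
proof -
  define z where "z i = (\<Sum>s | s \<le> m \<and> f s = i. \<sigma> s)" for i
  have zf: "z (f s) = \<sigma> s" if "s \<le> m" for s
  proof -
    have "{k. k \<le> m \<and> f k = f s} = {s}" using inj_f that by (auto simp: inj_on_def)
    then show ?thesis by (simp add: z_def)
  qed
  have z0: "z i = 0" if "i \<notin> f ` {..m}" for i
  proof -
    have "{s. s \<le> m \<and> f s = i} = {}" using that by auto
    then show ?thesis by (simp only: z_def sum.empty)
  qed
  have k: "(\<Sum>i<d. z i * u i (q t)) = 0" if "t < m" for t
  proof -
    have "(\<Sum>i<d. z i * u i (q t)) = (\<Sum>s\<le>m. z (f s) * u (f s) (q t))"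
      by (rule sum_over_path) (rule z0)
    also have "\<dots> = z (f t) * u (f t) (q t) + z (f (Suc t)) * u (f (Suc t)) (q t)"
      by (rule sum_two_neighbours) (use that chordless in auto)
    also have "\<dots> = 0" using that edges[of t] by (auto simp: zf)
    finally show ?thesis .
  qed
  have "(\<Sum>i<d. z i * u i e) = (\<Sum>s\<le>m. z (f s) * u (f s) e)"
    by (rule sum_over_path) (rule z0)
  also have "\<dots> = z (f 0) * u (f 0) e + z (f m) * u (f m) e"
    by (rule sum_two_ends) (use m_pos interior in auto)
  also have "even \<dots>" using ends sign_unit[of m] by (auto simp: zf)
  finally have "even (\<Sum>i<d. z i * u i e)" .
  then show thesis using that[of z] z0 k zf[of 0] by simp
qed

end

section \<open>Uniqueness of the representation up to scaling\<close>

text \<open>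
  A chord between two vertices that are not consecutive would shorten the walk.
\<close>

lemma shortest_walk_chordless:
  assumes walk: "\<And>i. i < m \<Longrightarrow> (f i, f (Suc i)) \<in> R"
    and shortest: "\<And>k. (f 0, f m) \<in> R ^^ k \<Longrightarrow> m \<le> k"
    and chord: "(f s, f t) \<in> R" and st: "s < t" "t \<le> m"
  shows "t = Suc s"
proof -
  have seg: "(f i, f j) \<in> R ^^ (j - i)" if "i \<le> j" "j \<le> m" for i j
    unfolding relpow_fun_conv
    by (rule exI[of _ "\<lambda>k. f (i + k)"]) (use that walk in auto)
  have "(f 0, f m) \<in> R ^^ (s + 1 + (m - t))"
    unfolding relpow_add
    using seg[of 0 s] seg[of t m] chord st by auto
  then show ?thesis using shortest[of "s + 1 + (m - t)"] st by linarith
qed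

text \<open>
  Two matrices, reduced to the identity on the basis \<open>b\<close>, with the same bases. What the argument uses
  of the unimodularity of \<open>u\<close> is \<open>singular_mod\<close>: a set of columns that becomes singular modulo
  some non-unit is already singular over the rationals.
\<close>

locale same_singular_sets =
  fixes d N :: nat and a :: "nat \<Rightarrow> nat \<Rightarrow> 'a::field" and u :: "nat \<Rightarrow> nat \<Rightarrow> int" and b :: "nat \<Rightarrow> nat"
  assumes b_less: "i < d \<Longrightarrow> b i < N"
    and a_b: "i < d \<Longrightarrow> k < d \<Longrightarrow> a i (b k) = (if i = k then 1 else 0)"
    and u_b: "i < d \<Longrightarrow> k < d \<Longrightarrow> u i (b k) = (if i = k then 1 else 0)"
    and singular_iff: "S \<subseteq> {..<N} \<Longrightarrow> card S = d \<Longrightarrow>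
      singular_on d a S \<longleftrightarrow> singular_on d (\<lambda>i e. rat_of_int (u i e)) S"
    and singular_mod: "S \<subseteq> {..<N} \<Longrightarrow> card S = d \<Longrightarrow> \<not> is_unit p \<Longrightarrow> i < d \<Longrightarrow> z i = 1 \<Longrightarrow>
      (\<And>e. e \<in> S \<Longrightarrow> p dvd (\<Sum>i<d. z i * u i e)) \<Longrightarrow>
      singular_on d (\<lambda>i e. rat_of_int (u i e)) S"
begin

lemma inj_b: "inj_on b {..<d}"
proof (rule inj_onI)
  fix i k assume "i \<in> {..<d}" "k \<in> {..<d}" "b i = b k"
  then show "i = k" using u_b[of i i] u_b[of i k] by (auto split: if_splits)
qed

lemma sum_at_basis:
  assumes "k < d"
  shows "(\<Sum>i<d. y i * a i (b k)) = y k"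
    and "(\<Sum>i<d. z i * rat_of_int (u i (b k))) = z k"
    and "(\<Sum>i<d. z' i * u i (b k)) = z' k"
proof -
  have "(\<Sum>i<d. y i * a i (b k)) = (\<Sum>i<d. if i = k then y i else 0)"
    by (rule sum.cong) (use a_b assms in auto)
  then show "(\<Sum>i<d. y i * a i (b k)) = y k" using assms by simp
  have "(\<Sum>i<d. z i * rat_of_int (u i (b k))) = (\<Sum>i<d. if i = k then z i else 0)"
    by (rule sum.cong) (use u_b assms in auto)
  then show "(\<Sum>i<d. z i * rat_of_int (u i (b k))) = z k" using assms by simp
  have "(\<Sum>i<d. z' i * u i (b k)) = (\<Sum>i<d. if i = k then z' i else 0)"
    by (rule sum.cong) (use u_b assms in auto)
  then show "(\<Sum>i<d. z' i * u i (b k)) = z' k" using assms by simp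
qed

text \<open>
  All column sets to be tested arise from the basis by exchanging the members that belong to the rows
  in \<open>P\<close> for the columns in \<open>Q\<close>. A hyperplane through the remaining members has coefficients
  supported on \<open>P\<close>.
\<close>

lemma exchange_set:
  assumes "P \<subseteq> {..<d}" "finite Q" "Q \<subseteq> {..<N}" "card P = card Q" "Q \<inter> b ` ({..<d} - P) = {}"
  shows "b ` ({..<d} - P) \<union> Q \<subseteq> {..<N}" "card (b ` ({..<d} - P) \<union> Q) = d"
proof -
  show "b ` ({..<d} - P) \<union> Q \<subseteq> {..<N}" using assms b_less by auto
  have fP: "finite P" using assms(1) finite_subset by blast
  have "card (b ` ({..<d} - P)) = card ({..<d} - P)"
    by (rule card_image) (rule inj_on_subset[OF inj_b], auto)
  also have "\<dots> = d - card P" using assms(1) fP by (simp add: card_Diff_subset)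
  finally have "card (b ` ({..<d} - P) \<union> Q) = d - card P + card Q"
    using assms by (subst card_Un_disjoint) auto
  moreover have "card P \<le> d" using card_mono[OF _ assms(1)] by simp
  ultimately show "card (b ` ({..<d} - P) \<union> Q) = d" using assms(4) by simp
qed

text \<open>
  Exchanging the \<open>i\<close>-th basis member for \<open>j\<close> yields a basis if and only if the entry at \<open>(i, j)\<close> is
  nonzero. In \<open>u\<close> such an entry is a unit: otherwise the exchanged set would be singular modulo the
  entry itself.
\<close>

lemma entry_support_and_unit:
  assumes "i < d" "j < N"
  shows "a i j = 0 \<longleftrightarrow> u i j = 0" and "u i j \<in> {-1, 0, 1}"
proof -
  have "(a i j = 0 \<longleftrightarrow> u i j = 0) \<and> u i j \<in> {-1, 0, 1}"
  proof (cases "j \<in> b ` {..<d}")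
    case True
    then show ?thesis using a_b u_b assms by auto
  next
    case False
    define S where "S = b ` ({..<d} - {i}) \<union> {j}"
    have S: "S \<subseteq> {..<N}" "card S = d"
      using exchange_set[of "{i}" "{j}", folded S_def] False assms by auto
    have e1: "(\<Sum>k<d. (if k = i then 1 else 0) * h k) = h i" for h :: "nat \<Rightarrow> 'c::comm_ring_1"
      using assms(1) by (subst sum.mono_neutral_right[of _ "{i}"]) auto
    have sa: "singular_on d a S \<longleftrightarrow> a i j = 0"
    proof
      assume "singular_on d a S"
      then obtain y where y: "\<exists>k<d. y k \<noteq> 0" "\<And>e. e \<in> S \<Longrightarrow> (\<Sum>k<d. y k * a k e) = 0"
        unfolding singular_on_def by blast
      have y0: "y k = 0" if "k < d" "k \<noteq> i" for k
        using y(2)[of "b k"] sum_at_basis(1)[OF that(1)] that by (auto simp: S_def)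
      have "(\<Sum>k<d. y k * a k j) = y i * a i j"
        using assms(1) y0 by (subst sum.mono_neutral_right[of _ "{i}"]) auto
      then show "a i j = 0" using y y0 by (auto simp: S_def)
    next
      assume *: "a i j = 0"
      show "singular_on d a S" unfolding singular_on_def
        by (rule exI[of _ "\<lambda>k. if k = i then 1 else 0"])
          (use * assms in \<open>auto simp: S_def e1 a_b\<close>)
    qed
    have su: "singular_on d (\<lambda>i e. rat_of_int (u i e)) S \<longleftrightarrow> u i j = 0"
    proof
      assume "singular_on d (\<lambda>i e. rat_of_int (u i e)) S"
      then obtain y where y: "\<exists>k<d. y k \<noteq> 0" "\<And>e. e \<in> S \<Longrightarrow> (\<Sum>k<d. y k * rat_of_int (u k e)) = 0"
        unfolding singular_on_def by blast
      have y0: "y k = 0" if "k < d" "k \<noteq> i" for k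
        using y(2)[of "b k"] sum_at_basis(2)[OF that(1)] that by (auto simp: S_def)
      have "(\<Sum>k<d. y k * rat_of_int (u k j)) = y i * rat_of_int (u i j)"
        using assms(1) y0 by (subst sum.mono_neutral_right[of _ "{i}"]) auto
      then show "u i j = 0" using y y0 by (auto simp: S_def)
    next
      assume *: "u i j = 0"
      show "singular_on d (\<lambda>i e. rat_of_int (u i e)) S" unfolding singular_on_def
        by (rule exI[of _ "\<lambda>k. if k = i then 1 else 0"])
          (use * assms in \<open>auto simp: S_def e1 u_b\<close>)
    qed
    have "is_unit (u i j)" if "u i j \<noteq> 0"
    proof (rule ccontr)
      assume nu: "\<not> is_unit (u i j)"
      have "singular_on d (\<lambda>i e. rat_of_int (u i e)) S"
        by (rule singular_mod[OF S nu assms(1), of "\<lambda>k. if k = i then 1 else 0"])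
          (use assms in \<open>auto simp: S_def e1 u_b split: if_splits\<close>)
      then show False using su that by simp
    qed
    then show ?thesis using sa su singular_iff[OF S] by auto
  qed
  then show "a i j = 0 \<longleftrightarrow> u i j = 0" and "u i j \<in> {-1, 0, 1}" by blast+
qed

lemma unit_entry: "i < d \<Longrightarrow> j < N \<Longrightarrow> u i j \<noteq> 0 \<Longrightarrow> u i j \<in> {-1, 1}"
  using entry_support_and_unit(2) by blast

text \<open>
  The sign vector of the path makes the exchanged set singular modulo \<open>2\<close>, so the set is singular
  for both matrices. Comparing what the two annihilators say about the ends of the path gives the
  equality of the ratios.
\<close>

lemma ratio_along_chordless_path:
  assumes "chordless_path u f q m e d"
    and q: "\<And>t. t < m \<Longrightarrow> q t < N" "inj_on q {..<m}" and e: "e < N" "e \<notin> q ` {..<m}"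
    and scaled: "\<And>s t. s \<le> m \<Longrightarrow> t < m \<Longrightarrow> a (f s) (q t) = r (f s) * c (q t) * of_int (u (f s) (q t))"
    and c: "\<And>t. t < m \<Longrightarrow> c (q t) \<noteq> 0"
    and r: "\<And>s. s \<le> m \<Longrightarrow> r (f s) \<noteq> 0"
    and ratio: "\<And>s. s \<le> m \<Longrightarrow> a (f s) e = w (f s) * r (f s) * of_int (u (f s) e)"
  shows "w (f 0) = w (f m)"
proof -
  interpret chordless_path u f q m e d by fact
  define P where "P = f ` {..m}"
  define Q where "Q = q ` {..<m} \<union> {e}"
  define S where "S = b ` ({..<d} - P) \<union> Q"
  have P: "P \<subseteq> {..<d}" using f_less by (auto simp: P_def)
  have cP: "card P = Suc m" using card_image[OF inj_f] by (simp add: P_def)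
  have cQ: "card Q = Suc m" using card_image[OF q(2)] e(2) by (simp add: Q_def)
  (* Every column of Q meets two rows, so it is not one of the unit columns of the basis. *)
  have two: "\<exists>i k. i < d \<and> k < d \<and> i \<noteq> k \<and> u i x \<noteq> 0 \<and> u k x \<noteq> 0" if x: "x \<in> Q" for x
  proof (cases "x = e")
    case True
    have "f 0 \<noteq> f m" using inj_f m_pos by (auto simp: inj_on_def)
    moreover have "u (f 0) e \<noteq> 0" "u (f m) e \<noteq> 0" using ends by auto
    ultimately show ?thesis using f_less[of 0] f_less[of m] True by blast
  next
    case False
    obtain t where t: "t < m" "x = q t" using x False unfolding Q_def by blast
    have "f t \<noteq> f (Suc t)" using inj_onD[OF inj_f, of t "Suc t"] t by auto
    moreover have "u (f t) x \<noteq> 0" "u (f (Suc t)) x \<noteq> 0" using edges[of t] t by auto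
    ultimately show ?thesis using f_less[of t] f_less[of "Suc t"] t by (metis Suc_leI less_imp_le)
  qed
  have "x \<noteq> b l" if "x \<in> Q" "l < d" for x l
    using two[OF that(1)] u_b[OF _ that(2)] by metis
  then have "Q \<inter> b ` ({..<d} - P) = {}" by blast
  then have S: "S \<subseteq> {..<N}" "card S = d"
    using exchange_set[of P Q] P cP cQ q(1) e(1) unfolding S_def Q_def by auto
  obtain z where z: "z (f 0) = 1" "\<And>i. i \<notin> f ` {..m} \<Longrightarrow> z i = (0::int)"
    "\<And>t. t < m \<Longrightarrow> (\<Sum>i<d. z i * u i (q t)) = 0" "even (\<Sum>i<d. z i * u i e)"
    using sign_vector by blast
  have sing_u: "singular_on d (\<lambda>i e. rat_of_int (u i e)) S"
    by (rule singular_mod[OF S, of 2 "f 0" z])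
      (use z f_less[of 0] in \<open>auto simp: S_def Q_def P_def sum_at_basis\<close>)
  then have sing_a: "singular_on d a S" using singular_iff[OF S] by simp
  have "rat_of_int (u (f 0) e) = - of_int (\<sigma> m) * rat_of_int (u (f m) e)"
  proof -
    obtain y where y: "\<exists>k<d. y k \<noteq> 0" "\<And>e. e \<in> S \<Longrightarrow> (\<Sum>k<d. y k * rat_of_int (u k e)) = 0"
      using sing_u unfolding singular_on_def by blast
    have "y i = 0" if "i < d" "i \<notin> f ` {..m}" for i
      using y(2)[of "b i"] sum_at_basis(2)[OF that(1)] that by (auto simp: S_def P_def)
    from annihilator_on_path[where a = "\<lambda>i e. rat_of_int (u i e)" and y = y and r = "\<lambda>_. 1"
        and c = "\<lambda>_. 1" and w = "\<lambda>_. 1", OF this y(1)]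
    show ?thesis using y(2) by (simp add: S_def Q_def)
  qed
  then have u_ends: "u (f 0) e = - \<sigma> m * u (f m) e"
    by (metis of_int_eq_iff of_int_minus of_int_mult)
  have "w (f 0) * of_int (u (f 0) e) = - of_int (\<sigma> m) * (w (f m) * of_int (u (f m) e))"
  proof -
    obtain y where y: "\<exists>k<d. y k \<noteq> 0" "\<And>e. e \<in> S \<Longrightarrow> (\<Sum>k<d. y k * a k e) = 0"
      using sing_a unfolding singular_on_def by blast
    have "y i = 0" if "i < d" "i \<notin> f ` {..m}" for i
      using y(2)[of "b i"] sum_at_basis(1)[OF that(1)] that by (auto simp: S_def P_def)
    then show ?thesis
      by (rule annihilator_on_path[where a = a and y = y and r = r and c = c and w = w])
        (use y scaled c r ratio in \<open>auto simp: S_def Q_def\<close>)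
  qed
  then show ?thesis using u_ends ends sign_unit[of m] by auto
qed

text \<open>
  Rows that meet a common column among the first \<open>n\<close>. Scaling the first \<open>n\<close> columns fixes the row
  factors up to a common factor on each connected component of this relation.
\<close>

definition linked :: "nat \<Rightarrow> (nat \<times> nat) set" where
  "linked n = {(i, k). i < d \<and> k < d \<and> (\<exists>j<n. u i j \<noteq> 0 \<and> u k j \<noteq> 0)}"

lemma sym_linked: "sym (linked n)"
  by (auto simp: linked_def sym_def)

text \<open>
  Among all pairs of rows that contradict the claim choose one at minimal distance. Minimality makes the
  shortest walk between them chordless, and column \<open>n\<close> vanishes on its inner rows since such a row
  would form a closer contradicting pair with one of the ends.
\<close>

lemma ratio_on_component:
  assumes n: "n < N"
    and scaled: "\<And>i j. i < d \<Longrightarrow> j < n \<Longrightarrow> a i j = r i * c j * of_int (u i j)"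
    and c: "\<And>j. j < n \<Longrightarrow> c j \<noteq> 0"
    and r: "\<And>i. i < d \<Longrightarrow> r i \<noteq> 0"
    and ratio: "\<And>i. i < d \<Longrightarrow> a i n = w i * r i * of_int (u i n)"
    and conn: "(i, k) \<in> (linked n)\<^sup>*" and ik: "i < d" "u i n \<noteq> 0" "k < d" "u k n \<noteq> 0"
  shows "w i = w k"
proof (rule ccontr)
  assume neq: "w i \<noteq> w k"
  define Bad where "Bad m \<longleftrightarrow> (\<exists>i k. (i, k) \<in> linked n ^^ m \<and> i < d \<and> k < d \<and>
      u i n \<noteq> 0 \<and> u k n \<noteq> 0 \<and> w i \<noteq> w k)" for m
  have "\<exists>m. Bad m" using neq ik conn unfolding Bad_def rtrancl_power by blast
  define m where "m = (LEAST m. Bad m)"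
  have "Bad m" unfolding m_def using \<open>\<exists>m. Bad m\<close> by (rule LeastI_ex)
  have least: "Bad m' \<Longrightarrow> m \<le> m'" for m' unfolding m_def by (rule Least_le)
  from \<open>Bad m\<close> obtain f where f: "\<And>t. t < m \<Longrightarrow> (f t, f (Suc t)) \<in> linked n"
    and f_ends: "f 0 < d" "f m < d" "u (f 0) n \<noteq> 0" "u (f m) n \<noteq> 0" "w (f 0) \<noteq> w (f m)"
    unfolding Bad_def relpow_fun_conv by blast
  have m_pos: "0 < m" using f_ends(5) by (cases m) auto
  have f_less: "f s < d" if "s \<le> m" for s
    using f[of s] f_ends(2) that by (cases "s = m") (auto simp: linked_def)
  have seg: "(f s, f t) \<in> linked n ^^ (t - s)" if "s \<le> t" "t \<le> m" for s t
    unfolding relpow_fun_conv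
    by (rule exI[of _ "\<lambda>k. f (s + k)"]) (use that f in auto)
  have shortest: "m \<le> k" if "(f 0, f m) \<in> linked n ^^ k" for k
    using least[of k] that f_ends unfolding Bad_def by blast
  have next_only: "t = Suc s" if "(f s, f t) \<in> linked n" "s < t" "t \<le> m" for s t
    by (rule shortest_walk_chordless[OF f shortest that])
  obtain q where q: "\<And>t. t < m \<Longrightarrow> q t < n \<and> u (f t) (q t) \<noteq> 0 \<and> u (f (Suc t)) (q t) \<noteq> 0"
    using f unfolding linked_def by simp metis
  have chordless: "u (f s) (q t) = 0" if "s \<le> m" "t < m" "s \<noteq> t" "s \<noteq> Suc t" for s t
  proof (rule ccontr)
    assume nz: "u (f s) (q t) \<noteq> 0"
    have "(f s, f (Suc t)) \<in> linked n" "(f t, f s) \<in> linked n"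
      using nz q[OF that(2)] f_less that by (auto simp: linked_def)
    then show False using next_only[of s "Suc t"] next_only[of t s] that by linarith
  qed
  have interior: "u (f s) n = 0" if "0 < s" "s < m" for s
  proof (rule ccontr)
    assume nz: "u (f s) n \<noteq> 0"
    have "w (f 0) = w (f s)"
      using least[of s] seg[of 0 s] nz f_less[of s] f_ends that unfolding Bad_def by fastforce
    moreover have "w (f s) = w (f m)"
      using least[of "m - s"] seg[of s m] nz f_less[of s] f_ends that unfolding Bad_def by fastforce
    ultimately show False using f_ends(5) by simp
  qed
  have inj_f: "inj_on f {..m}"
  proof (rule linorder_inj_onI)
    fix s t assume st: "s < t" "s \<in> {..m}" "t \<in> {..m}"
    show "f s \<noteq> f t"
    proof
      assume eq: "f s = f t"
      have "(f s, f t) \<in> linked n"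
        using f[of s] st unfolding eq[symmetric] by (auto simp: linked_def)
      then have t: "t = Suc s" using next_only st by auto
      consider "t < m" | "t = m" "0 < s" | "t = m" "s = 0" using st by force
      then show False
      proof cases
        case 1
        then show False using chordless[of s t] q[of t] eq t by simp
      next
        case 2
        then show False using interior[of s] f_ends(4) eq t by simp
      next
        case 3
        then show False using f_ends(5) eq by simp
      qed
    qed
  qed auto
  have inj_q: "inj_on q {..<m}"
  proof (rule linorder_inj_onI)
    fix s t assume st: "s < t" "s \<in> {..<m}" "t \<in> {..<m}"
    then show "q s \<noteq> q t" using chordless[of "Suc t" s] q[of t] by fastforce
  qed auto
  have path: "chordless_path u f q m n d"
  proof
    fix t assume t: "t < m"
    show "u (f t) (q t) \<in> {-1, 1}" "u (f (Suc t)) (q t) \<in> {-1, 1}"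
      using unit_entry q[OF t] f_less t n by auto
  qed (use m_pos inj_f f_less chordless interior f_ends unit_entry n in auto)
  have "w (f 0) = w (f m)"
    by (rule ratio_along_chordless_path[OF path _ inj_q n])
      (use q n f_less scaled c r ratio in \<open>auto intro: less_trans\<close>)
  then show False using f_ends(5) by simp
qed

text \<open>
  In the induction step the factor of every row in a component is multiplied by the ratio \<open>w\<close> that
  column \<open>n\<close> has there, and the factors of the earlier columns meeting that component are divided by
  it. Components that column \<open>n\<close> does not meet keep their factors.
\<close>

lemma scaling_equivalent_up_to:
  assumes "n \<le> N"
  shows "\<exists>r c. (\<forall>i<d. r i \<noteq> 0) \<and> (\<forall>j<n. c j \<noteq> 0) \<and>
      (\<forall>i<d. \<forall>j<n. a i j = r i * c j * of_int (u i j))"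
  using assms
proof (induction n)
  case 0
  show ?case by (rule exI[of _ "\<lambda>_. 1"]) auto
next
  case (Suc n)
  then obtain r c where r: "\<And>i. i < d \<Longrightarrow> r i \<noteq> 0" and c: "\<And>j. j < n \<Longrightarrow> c j \<noteq> 0"
    and scaled: "\<And>i j. i < d \<Longrightarrow> j < n \<Longrightarrow> a i j = r i * c j * of_int (u i j)"
    by (metis Suc_leD)
  have n: "n < N" using Suc.prems by simp
  define w where "w i = a i n / (r i * of_int (u i n))" for i
  (* In positive characteristic a nonzero integer may vanish, but not a unit. *)
  have cast: "of_int (u i n) \<noteq> (0::'a)" if "i < d" "u i n \<noteq> 0" for i
    using unit_entry[OF that(1) n that(2)] by auto
  have ratio: "a i n = w i * r i * of_int (u i n)" if "i < d" for i
    using entry_support_and_unit(1)[OF that n] cast[OF that] r[OF that]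
    by (cases "u i n = 0") (auto simp: w_def)
  have w: "w i \<noteq> 0" if "i < d" "u i n \<noteq> 0" for i
    using entry_support_and_unit(1)[OF that(1) n] ratio[OF that(1)] that by auto
  have w_const: "w i = w k" if "(i, k) \<in> (linked n)\<^sup>*" "i < d" "u i n \<noteq> 0" "k < d" "u k n \<noteq> 0" for i k
    by (rule ratio_on_component[OF n scaled c r ratio that])
  define meets where "meets i k \<longleftrightarrow> (i, k) \<in> (linked n)\<^sup>* \<and> k < d \<and> u k n \<noteq> 0" for i k
  define W where "W i = (if \<exists>k. meets i k then w (SOME k. meets i k) else 1)" for i
  have W_eq: "W i = w k" if "meets i k" for i k
  proof -
    have s: "meets i (SOME k. meets i k)" using that by (rule someI)
    have "(SOME k. meets i k, i) \<in> (linked n)\<^sup>*"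
      using s sym_rtrancl[OF sym_linked] unfolding meets_def by (auto dest: symD)
    then have "(SOME k. meets i k, k) \<in> (linked n)\<^sup>*"
      using that unfolding meets_def by auto
    then have "w (SOME k. meets i k) = w k" using s that w_const unfolding meets_def by blast
    then show ?thesis using that unfolding W_def by auto
  qed
  have W_nz: "W i \<noteq> 0" for i
  proof (cases "\<exists>k. meets i k")
    case True
    then obtain k where "meets i k" by blast
    then show ?thesis using W_eq w unfolding meets_def by metis
  qed (simp add: W_def)
  have W_linked: "W i = W k" if "(i, k) \<in> linked n" for i k
  proof -
    have "(k, i) \<in> linked n" using that sym_linked by (auto dest: symD)
    then have "meets i = meets k"
      using that unfolding meets_def by (auto intro: converse_rtrancl_into_rtrancl)
    then show ?thesis by (simp only: W_def)
  qed
  define r' where "r' i = r i * W i" for i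
  (* All rows meeting column j < n lie in one component, so any of them gives the divisor;
     a zero column keeps its factor. *)
  define c' where "c' j = (if j = n then 1 else c j /
      (if \<exists>i<d. u i j \<noteq> 0 then W (SOME i. i < d \<and> u i j \<noteq> 0) else 1))" for j
  have "a i j = r' i * c' j * of_int (u i j)" if ij: "i < d" "j < Suc n" for i j
  proof (cases "j = n")
    case True
    show ?thesis
    proof (cases "u i n = 0")
      case False
      then have "meets i i" using ij by (simp add: meets_def)
      then show ?thesis using ratio[OF ij(1)] W_eq True by (simp add: r'_def c'_def)
    qed (use True ratio ij in simp)
  next
    case False
    then have j: "j < n" using ij by simp
    show ?thesis
    proof (cases "u i j = 0")
      case nz: False
      have s: "(SOME i. i < d \<and> u i j \<noteq> 0) < d \<and> u (SOME i. i < d \<and> u i j \<noteq> 0) j \<noteq> 0"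
        by (rule someI[of _ i]) (use nz ij in simp)
      have "W (SOME i. i < d \<and> u i j \<noteq> 0) = W i"
        by (rule W_linked) (use s nz ij j in \<open>auto simp: linked_def\<close>)
      then have "c' j = c j / W i" using False nz ij by (auto simp: c'_def)
      then show ?thesis using scaled[OF ij(1) j] W_nz[of i] by (simp add: r'_def)
    qed (use scaled ij j in simp)
  qed
  moreover have "r' i \<noteq> 0" if "i < d" for i using r[OF that] W_nz by (simp add: r'_def)
  moreover have "c' j \<noteq> 0" if "j < Suc n" for j using c[of j] W_nz that by (auto simp: c'_def)
  ultimately show ?case by (intro exI[of _ r'] exI[of _ c'] conjI allI impI) simp_all
qed

end

section \<open>Minors of a regular matrix and their powers\<close>

text \<open>
  Left multiplication by an invertible matrix reduces both \<open>X\<close> and its integer model to the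
  identity on \<open>B\<close> and changes the maximal minors by a common factor. Without rows the only maximal
  minor is the empty determinant \<open>1\<close>, which no scaling can change; hence the separate clause for
  \<open>d = 0\<close>.
\<close>

lemma minors_of_regular_matrix:
  fixes X :: "'a::field mat"
  assumes X: "X \<in> carrier_mat d N" and rank_X: "vec_space.rank d X = d"
    and regular: "regular_matroid (matroid_of X)"
  obtains U :: "int mat" and \<gamma> :: 'a and c :: "nat \<Rightarrow> 'a" where "U \<in> carrier_mat d N"
    and "\<And>I. I \<subseteq> {..<N} \<Longrightarrow> card I = d \<Longrightarrow> minor U I \<in> {-1, 0, 1}"
    and "\<gamma> \<noteq> 0" "d = 0 \<Longrightarrow> \<gamma> = 1" "\<And>j. j < N \<Longrightarrow> c j \<noteq> 0"
    and "\<And>I. I \<subseteq> {..<N} \<Longrightarrow> card I = d \<Longrightarrow>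
      minor X I = \<gamma> * (\<Prod>j\<in>I. c j) * of_int (minor U I)"
proof -
  obtain V :: "int mat" and B where V: "V \<in> carrier_mat d N"
    and V_unimod: "\<And>I. I \<subseteq> {..<N} \<Longrightarrow> card I = d \<Longrightarrow> minor V I \<in> {-1, 0, 1}"
    and V_zero: "\<And>I. I \<subseteq> {..<N} \<Longrightarrow> card I = d \<Longrightarrow> minor V I = 0 \<longleftrightarrow> minor X I = 0"
    and B: "B \<subseteq> {..<N}" "card B = d" and minor_B: "minor X B \<noteq> 0"
    using unimodular_model[OF assms] by metis
  note sV = submatrix_all_rows[OF V B(1), unfolded B(2)]
  note sX = submatrix_all_rows[OF X B(1), unfolded B(2)]
  have "minor V B * det (submatrix V UNIV B) = 1"
    using V_unimod[OF B] V_zero[OF B] minor_B by (auto simp: minor_def)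
  then obtain P where P: "P \<in> carrier_mat d d" "P * submatrix V UNIV B = 1\<^sub>m d"
    using left_inverse_if_unit_det[OF sV(1)] by metis
  have "inverse (minor X B) * det (submatrix X UNIV B) = 1"
    using minor_B by (simp add: minor_def)
  then obtain Q where Q: "Q \<in> carrier_mat d d" "Q * submatrix X UNIV B = 1\<^sub>m d"
    using left_inverse_if_unit_det[OF sX(1)] by metis
  have "det P * minor V B = 1"
    using det_mult[OF P(1) sV(1)] P(2) by (simp add: minor_def)
  then have det_P: "det P \<in> {-1, 1}" by (metis insert_iff zmult_eq_1_iff)
  have "det Q * minor X B = 1"
    using det_mult[OF Q(1) sX(1)] Q(2) by (simp add: minor_def)
  then have det_Q: "det Q \<noteq> 0" by auto
  define U where "U = P * V"
  define Y where "Y = Q * X"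
  have U: "U \<in> carrier_mat d N" and Y: "Y \<in> carrier_mat d N" using P Q V X by (auto simp: U_def Y_def)
  have U_minor: "minor U I = det P * minor V I" if "I \<subseteq> {..<N}" "card I = d" for I
    unfolding U_def by (rule minor_mult_left[OF P(1) V that])
  have Y_minor: "minor Y I = det Q * minor X I" if "I \<subseteq> {..<N}" "card I = d" for I
    unfolding Y_def by (rule minor_mult_left[OF Q(1) X that])
  have U_unimod: "minor U I \<in> {-1, 0, 1}" if "I \<subseteq> {..<N}" "card I = d" for I
    using V_unimod[OF that] det_P by (auto simp: U_minor[OF that])
  have U_zero: "minor U I = 0 \<longleftrightarrow> minor Y I = 0" if "I \<subseteq> {..<N}" "card I = d" for I
    using V_zero[OF that] det_P det_Q by (auto simp: U_minor[OF that] Y_minor[OF that])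
  have U_singular: "singular_on d (\<lambda>i e. rat_of_int (U $$ (i, e))) S \<longleftrightarrow> minor U S = 0"
    if S: "S \<subseteq> {..<N}" "card S = d" for S
  proof -
    have map_U: "map_mat rat_of_int U \<in> carrier_mat d N" using U by simp
    have "minor (map_mat rat_of_int U) S = 0 \<longleftrightarrow> minor U S = 0"
      by (simp add: minor_of_int[OF U S])
    moreover have "singular_on d (\<lambda>i e. map_mat rat_of_int U $$ (i, e)) S
        \<longleftrightarrow> singular_on d (\<lambda>i e. rat_of_int (U $$ (i, e))) S"
      unfolding singular_on_def using U S by (intro ex_cong1 conj_cong ball_cong refl) (auto simp: subset_iff)
    ultimately show ?thesis using minor_zero_iff_singular_on[OF map_U S] by simp
  qed
  interpret same_singular_sets d N "\<lambda>i j. Y $$ (i, j)" "\<lambda>i j. U $$ (i, j)" "pick B"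
  proof
    show "pick B i < N" if "i < d" for i using pick_less[OF B(1)] B(2) that by simp
    show "Y $$ (i, pick B k) = (if i = k then 1 else 0)" if "i < d" "k < d" for i k
      using submatrix_all_rows(2)[OF Y B(1), of i k] submatrix_mult_left[OF Q(1) X B(1)] Q(2) that B(2)
      by (simp add: Y_def)
    show "U $$ (i, pick B k) = (if i = k then 1 else 0)" if "i < d" "k < d" for i k
      using submatrix_all_rows(2)[OF U B(1), of i k] submatrix_mult_left[OF P(1) V B(1)] P(2) that B(2)
      by (simp add: U_def)
  next
    fix S assume S: "S \<subseteq> {..<N}" "card S = d"
    show "singular_on d (\<lambda>i j. Y $$ (i, j)) S \<longleftrightarrow> singular_on d (\<lambda>i e. rat_of_int (U $$ (i, e))) S"
      using minor_zero_iff_singular_on[OF Y S] U_zero[OF S] U_singular[OF S] by simp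
    fix p z i
    assume "\<not> is_unit p" "i < d" "z i = 1" "\<And>e. e \<in> S \<Longrightarrow> p dvd (\<Sum>k<d. z k * U $$ (k, e))"
    then show "singular_on d (\<lambda>i e. rat_of_int (U $$ (i, e))) S"
      using minor_zero_if_annihilated_mod[OF U S U_unimod[OF S]] U_singular[OF S] by blast
  qed
  obtain r c where r: "\<And>i. i < d \<Longrightarrow> r i \<noteq> 0" and c: "\<And>j. j < N \<Longrightarrow> c j \<noteq> 0"
    and scaled: "\<And>i j. i < d \<Longrightarrow> j < N \<Longrightarrow> Y $$ (i, j) = r i * c j * of_int (U $$ (i, j))"
    using scaling_equivalent_up_to[of N] by blast
  have map_U: "map_mat (of_int :: int \<Rightarrow> 'a) U \<in> carrier_mat d N" using U by simp
  have Y_eq: "Y = mat d N (\<lambda>(i, j). r i * c j * map_mat of_int U $$ (i, j))"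
    using Y U by (intro eq_matI) (auto simp: scaled)
  have minors: "minor X I = (\<Prod>i<d. r i) / det Q * (\<Prod>j\<in>I. c j) * of_int (minor U I)"
    if I: "I \<subseteq> {..<N}" "card I = d" for I
  proof -
    have "det Q * minor X I = (\<Prod>i<d. r i) * (\<Prod>j\<in>I. c j) * of_int (minor U I)"
      unfolding Y_minor[OF I, symmetric] Y_eq
      using minor_row_col_scaling[OF map_U I] minor_of_int[OF U I, where 'a = 'a] by simp
    then show ?thesis using det_Q by (simp add: field_simps)
  qed
  have nonzero: "(\<Prod>i<d. r i) / det Q \<noteq> 0" using det_Q r by simp
  have empty: "(\<Prod>i<d. r i) / det Q = 1" if "d = 0"
    using Q(1) that by (simp add: det_dim_zero)
  show thesis by (rule that[OF U U_unimod nonzero empty c minors])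
qed

text \<open>
  Applying \<open>f\<close> to the factors of \<open>minors_of_regular_matrix\<close> leaves the sign \<open>\<epsilon> I\<close> of the integer
  minor untouched, whereas applying \<open>f\<close> to the whole minor turns it into \<open>f (\<epsilon> I)\<close>. For
  \<open>\<epsilon> I = -1\<close> the two differ by the factor \<open>- f (-1)\<close>, whose square is \<open>1\<close>.
\<close>

lemma minors_under_multiplicative_map:
  fixes X :: "'a::field mat"
  assumes X: "X \<in> carrier_mat d N" and rank_X: "vec_space.rank d X = d"
    and regular: "regular_matroid (matroid_of X)"
    and f_mult: "\<And>x y. x \<noteq> 0 \<Longrightarrow> y \<noteq> 0 \<Longrightarrow> f (x * y) = f x * f y"
    and f_1: "f 1 = (1 :: 'a)"
  shows "\<exists>Xf\<in>carrier_mat d N. \<forall>I. I \<subseteq> {..<N} \<longrightarrow> card I = d \<longrightarrow>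
    (if minor X I = 0 then minor Xf I = 0
     else minor Xf I = f (minor X I) \<or> minor Xf I = - f (- 1) * f (minor X I))"
proof -
  obtain U :: "int mat" and \<gamma> :: 'a and c :: "nat \<Rightarrow> 'a" where U: "U \<in> carrier_mat d N"
    and unimod: "\<And>I. I \<subseteq> {..<N} \<Longrightarrow> card I = d \<Longrightarrow> minor U I \<in> {-1, 0, 1}"
    and \<gamma>: "\<gamma> \<noteq> 0" "d = 0 \<Longrightarrow> \<gamma> = 1" and c: "\<And>j. j < N \<Longrightarrow> c j \<noteq> 0"
    and minors: "\<And>I. I \<subseteq> {..<N} \<Longrightarrow> card I = d \<Longrightarrow>
      minor X I = \<gamma> * (\<Prod>j\<in>I. c j) * of_int (minor U I)"
    using minors_of_regular_matrix[OF X rank_X regular] by metis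
  (* The first row carries the common factor; without rows that factor is f 1 = 1. *)
  define Xf where "Xf = mat d N (\<lambda>(i, j). (if i = 0 then f \<gamma> else 1) * f (c j) * map_mat of_int U $$ (i, j))"
  have prod_row: "(\<Prod>i<d. if i = 0 then f \<gamma> else 1) = f \<gamma>"
    using \<gamma>(2) f_1 by (cases "d = 0") (auto simp: prod.delta)
  have map_U: "map_mat (of_int :: int \<Rightarrow> 'a) U \<in> carrier_mat d N" using U by simp
  have Xf: "minor Xf I = f \<gamma> * (\<Prod>j\<in>I. f (c j)) * of_int (minor U I)"
    if I: "I \<subseteq> {..<N}" "card I = d" for I
    unfolding Xf_def minor_row_col_scaling[OF map_U I] minor_of_int[OF U I] prod_row ..
  have f_prod: "(\<Prod>j\<in>I. f (c j)) = f (\<Prod>j\<in>I. c j) \<and> (\<Prod>j\<in>I. c j) \<noteq> 0" if "I \<subseteq> {..<N}" for I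
    using finite_below[OF that] that
    by (induction I rule: finite_induct) (auto simp: f_1 f_mult c)
  have f_sq: "f (- 1) * f (- 1) = 1" using f_mult[of "- 1" "- 1"] f_1 by simp
  have "if minor X I = 0 then minor Xf I = 0
     else minor Xf I = f (minor X I) \<or> minor Xf I = - f (- 1) * f (minor X I)"
    if I: "I \<subseteq> {..<N}" "card I = d" for I
  proof -
    note fp = f_prod[OF I(1)]
    consider "minor U I = 0" | "minor U I = 1" | "minor U I = - 1" using unimod[OF I] by auto
    then show ?thesis
    proof cases
      case 1
      then show ?thesis using minors[OF I] Xf[OF I] by simp
    next
      case 2
      then show ?thesis using minors[OF I] Xf[OF I] fp f_mult \<gamma>(1) by simp
    next
      case 3
      have "f (minor X I) = f \<gamma> * f (\<Prod>j\<in>I. c j) * f (- 1)"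
        using minors[OF I] 3 fp \<gamma>(1) f_mult[of "\<gamma> * (\<Prod>j\<in>I. c j)" "- 1"] f_mult by simp
      then have "f (- 1) * f (minor X I) = f \<gamma> * f (\<Prod>j\<in>I. c j) * (f (- 1) * f (- 1))"
        by (simp only: ac_simps)
      then have "minor Xf I = - f (- 1) * f (minor X I)" using Xf[OF I] fp 3 f_sq by simp
      moreover have "minor X I \<noteq> 0" using minors[OF I] fp \<gamma>(1) 3 by simp
      ultimately show ?thesis by simp
    qed
  qed
  moreover have "Xf \<in> carrier_mat d N" by (simp add: Xf_def)
  ultimately show ?thesis by blast
qed

theorem theorem2p2:
  shows
    "(\<forall>d N (X :: 'a::field mat).
        X \<in> carrier_mat d N \<longrightarrow> d \<le> N \<longrightarrow> vec_space.rank d X = d \<longrightarrow>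
        regular_matroid (matroid_of X) \<longrightarrow>
          (\<forall>k::int. \<exists>Xk \<in> carrier_mat d N. \<forall>I. I \<subseteq> {..<N} \<longrightarrow> card I = d \<longrightarrow>
              int_pow0 (minor X I) k = minor Xk I \<or> int_pow0 (minor X I) k = - minor Xk I) \<and>
          (\<forall>k::int. odd k \<longrightarrow> (\<exists>Xk \<in> carrier_mat d N. \<forall>I. I \<subseteq> {..<N} \<longrightarrow> card I = d \<longrightarrow>
              int_pow0 (minor X I) k = minor Xk I)))
     \<and>
     (\<forall>d N (X :: 'b::linordered_field mat).
        X \<in> carrier_mat d N \<longrightarrow> d \<le> N \<longrightarrow> vec_space.rank d X = d \<longrightarrow>
        regular_matroid (matroid_of X) \<longrightarrow>
          (\<forall>p. power_map p \<longrightarrow> (\<exists>Xk \<in> carrier_mat d N. \<forall>I. I \<subseteq> {..<N} \<longrightarrow> card I = d \<longrightarrow>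
              ext0 p \<bar>minor X I\<bar> = \<bar>minor Xk I\<bar> \<and>
              minor Xk I * minor X I \<ge> 0)))"
proof (intro conjI allI impI)
  fix d N and X :: "'a mat" and k :: int
  assume X: "X \<in> carrier_mat d N" "vec_space.rank d X = d" "regular_matroid (matroid_of X)"
  obtain Xk where Xk: "Xk \<in> carrier_mat d N"
    "\<And>I. I \<subseteq> {..<N} \<Longrightarrow> card I = d \<Longrightarrow> if minor X I = 0 then minor Xk I = 0
      else minor Xk I = minor X I powi k \<or> minor Xk I = - ((- 1) powi k) * minor X I powi k"
    using minors_under_multiplicative_map[OF X, of "\<lambda>x. x powi k"]
    by (auto simp only: power_int_mult_distrib power_int_1_left)
  show "\<exists>Xk\<in>carrier_mat d N. \<forall>I. I \<subseteq> {..<N} \<longrightarrow> card I = d \<longrightarrow>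
      int_pow0 (minor X I) k = minor Xk I \<or> int_pow0 (minor X I) k = - minor Xk I"
  proof (intro bexI[OF _ Xk(1)] allI impI)
    fix I assume I: "I \<subseteq> {..<N}" "card I = d"
    have "(- 1 :: 'a) powi k = 1 \<or> (- 1 :: 'a) powi k = - 1" by (simp add: power_int_minus_left)
    then show "int_pow0 (minor X I) k = minor Xk I \<or> int_pow0 (minor X I) k = - minor Xk I"
      using Xk(2)[OF I] by (auto simp: int_pow0_def split: if_splits)
  qed
next
  fix d N and X :: "'a mat" and k :: int
  assume X: "X \<in> carrier_mat d N" "vec_space.rank d X = d" "regular_matroid (matroid_of X)"
    and k: "odd k"
  obtain Xk where Xk: "Xk \<in> carrier_mat d N"
    "\<And>I. I \<subseteq> {..<N} \<Longrightarrow> card I = d \<Longrightarrow> if minor X I = 0 then minor Xk I = 0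
      else minor Xk I = minor X I powi k \<or> minor Xk I = - ((- 1) powi k) * minor X I powi k"
    using minors_under_multiplicative_map[OF X, of "\<lambda>x. x powi k"]
    by (auto simp only: power_int_mult_distrib power_int_1_left)
  show "\<exists>Xk\<in>carrier_mat d N. \<forall>I. I \<subseteq> {..<N} \<longrightarrow> card I = d \<longrightarrow>
      int_pow0 (minor X I) k = minor Xk I"
  proof (intro bexI[OF _ Xk(1)] allI impI)
    fix I assume I: "I \<subseteq> {..<N}" "card I = d"
    show "int_pow0 (minor X I) k = minor Xk I"
      using Xk(2)[OF I] k by (auto simp: int_pow0_def power_int_minus_left split: if_splits)
  qed
next
  fix d N and X :: "'b mat" and p :: "'b \<Rightarrow> 'b"
  assume X: "X \<in> carrier_mat d N" "vec_space.rank d X = d" "regular_matroid (matroid_of X)"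
    and p: "power_map p"
  have p_pos: "p x > 0" if "x > 0" for x using p that by (simp add: power_map_def)
  have p_mult: "p (x * y) = p x * p y" if "x > 0" "y > 0" for x y using p that by (simp add: power_map_def)
  have p_1: "p 1 = 1" using p_mult[of 1 1] p_pos[of 1] by simp
  (* The sign is carried along unchanged, so that f (-1) = -1 and no sign is lost. *)
  define f where "f x = sgn x * p \<bar>x\<bar>" for x
  have f_mult: "f (x * y) = f x * f y" if "x \<noteq> 0" "y \<noteq> 0" for x y
    using that by (simp add: f_def sgn_mult abs_mult p_mult)
  have f_1: "f 1 = 1" by (simp add: f_def p_1)
  have f_minus: "f (- 1) = - 1" by (simp add: f_def p_1)
  obtain Xk where Xk: "Xk \<in> carrier_mat d N"
    "\<And>I. I \<subseteq> {..<N} \<Longrightarrow> card I = d \<Longrightarrow> if minor X I = 0 then minor Xk I = 0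
      else minor Xk I = f (minor X I) \<or> minor Xk I = - f (- 1) * f (minor X I)"
    using minors_under_multiplicative_map[OF X f_mult f_1] by blast
  have abs_f: "\<bar>f x\<bar> = p \<bar>x\<bar>" if "x \<noteq> 0" for x
    using p_pos[of "\<bar>x\<bar>"] that by (simp add: f_def abs_mult abs_sgn_eq)
  have f_same_sign: "f x * x \<ge> 0" if "x \<noteq> 0" for x
  proof -
    have "f x * x = p \<bar>x\<bar> * \<bar>x\<bar>" by (simp add: f_def sgn_if)
    then show ?thesis using p_pos[of "\<bar>x\<bar>"] that by simp
  qed
  show "\<exists>Xk\<in>carrier_mat d N. \<forall>I. I \<subseteq> {..<N} \<longrightarrow> card I = d \<longrightarrow>
      ext0 p \<bar>minor X I\<bar> = \<bar>minor Xk I\<bar> \<and> minor Xk I * minor X I \<ge> 0"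
  proof (intro bexI[OF _ Xk(1)] allI impI)
    fix I assume I: "I \<subseteq> {..<N}" "card I = d"
    show "ext0 p \<bar>minor X I\<bar> = \<bar>minor Xk I\<bar> \<and> minor Xk I * minor X I \<ge> 0"
    proof (cases "minor X I = 0")
      case False
      then have "minor Xk I = f (minor X I)" using Xk(2)[OF I] by (auto simp: f_minus)
      then show ?thesis using False abs_f f_same_sign by (simp add: ext0_def)
    qed (use Xk(2)[OF I] in \<open>simp add: ext0_def\<close>)
  qed
qed

end
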